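(* Let $\mathbb{F}$ be a field and let $L$ be a nilpotent symplectic alternating algebra over $\mathbb{F}$ of dimension $10$ with an isotropic center $Z(L)$ of dimension $2$, with the further properties that $L$ is of nilpotence class $6$ and $L^{3}L^{3}\not\leq Z(L)$. Then $L$ has a presentation of the form $$\mathcal{P}_{10}^{(2,2)}(r):\ (x_{3}y_{4},y_{5})=r,\ (x_{2}y_{3},y_{5})=1,\ (x_{1}y_{3},y_{4})=1,\ (y_{1}y_{2},y_{3})=1,$$ where $r\in\mathbb{F}$, $r\neq 0$. Furthermore, for $r,s\in\mathbb{F}^{*}$, the presentations $\mathcal{P}_{10}^{(2,2)}(r)$ and $\mathcal{P}_{10}^{(2,2)}(s)$ describe the same algebra (up to isomorphism) if and only if $s/r\in(\mathbb{F}^{*})^{4}$. Conversely, any algebra with such a presentation has the properties stated.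
   Context: A symplectic alternating algebra (SAA) over a field $\mathbb{F}$ is a finite-dimensional $\mathbb{F}$-vector space $L$ with a non-degenerate alternating bilinear form $(\cdot,\cdot)$ and a bilinear alternating product $L\times L\to L$, $(x,y)\mapsto xy$ (so $xx=0$), such that $(xy,z)=(yz,x)$ for all $x,y,z\in L$. Consequently $(u,v,w)\mapsto (uv,w)$ is an alternating trilinear form, and by non-degeneracy it determines the product. An isomorphism of SAAs is a linear bijection preserving both the product and the form. For subspaces $U,V\le L$, $UV$ denotes the linear span of all products $uv$ with $u\in U$, $v\in V$. Put $L^{1}=L$, $L^{k+1}=L^{k}L$; $L$ is nilpotent if $L^{k+1}=0$ for some $k$, and the smallest such $k$ is its (nilpotence) class. The center is $Z(L)=\{z\in L: zx=0 \text{ for all } x\in L\}$. A subspace $U$ is isotropic if $(u,v)=0$ for all $u,v\in U$. $\mathbb{F}^{*}=\mathbb{F}\setminus\{0\}$ and $(\mathbb{F}^{*})^{m}=\{a^{m}:a\in\mathbb{F}^{*}\}$. A standard basis of a $10$-dimensional $L$ is a basis $x_{1},y_{1},\ldots,x_{5},y_{5}$ with $(x_i,x_j)=(y_i,y_j)=0$ and $(x_i,y_j)=\delta_{ij}$. A nilpotent presentation lists values of the triples $(x_iy_j,y_k)$ and $(y_iy_j,y_k)$ with $1\le i<j<k\le 5$ with respect to a standard basis. By convention, all triple values $(uv,w)$ of basis vectors $u,v,w$ which do not follow from the listed ones by the alternating property are $0$. Such a presentation determines an SAA up to isomorphism. *)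

theory Defs
  imports "HOL-Analysis.Finite_Cartesian_Product" "HOL-Library.Numeral_Type"
begin

text \<open>The underlying set of an algebra is the whole type \<open>'v\<close>, whose addition is the
  vector addition; the record carries the rest of the structure.\<close>

record ('f, 'v) saa =
  smul :: "'f \<Rightarrow> 'v \<Rightarrow> 'v"
  form :: "'v \<Rightarrow> 'v \<Rightarrow> 'f"
  mul :: "'v \<Rightarrow> 'v \<Rightarrow> 'v"

locale symplectic_alternating_algebra =
  vector_space "smul L" for L :: "('f::field, 'v::ab_group_add) saa" +
  assumes finite_dim: "\<exists>B. finite B \<and> module.span (smul L) B = UNIV"
    and form_linear_left: "\<And>y. Vector_Spaces.linear (smul L) (*) (\<lambda>x. form L x y)"
    and form_linear_right: "\<And>x. Vector_Spaces.linear (smul L) (*) (\<lambda>y. form L x y)"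
    and form_alternating: "\<And>x. form L x x = 0"
    and form_nondegenerate: "\<And>x. (\<And>y. form L x y = 0) \<Longrightarrow> x = 0"
    and mul_linear_left: "\<And>y. Vector_Spaces.linear (smul L) (smul L) (\<lambda>x. mul L x y)"
    and mul_linear_right: "\<And>x. Vector_Spaces.linear (smul L) (smul L) (\<lambda>y. mul L x y)"
    and mul_alternating: "\<And>x. mul L x x = 0"
    and form_mul_cyclic: "\<And>x y z. form L (mul L x y) z = form L (mul L y z) x"

definition saa_iso ::
  "('f::field, 'v::ab_group_add) saa \<Rightarrow> ('f, 'w::ab_group_add) saa \<Rightarrow> ('v \<Rightarrow> 'w) \<Rightarrow> bool" where
  "saa_iso L M \<phi> \<longleftrightarrow>
     Vector_Spaces.linear (smul L) (smul M) \<phi> \<and> bij \<phi> \<and>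
     (\<forall>x y. \<phi> (mul L x y) = mul M (\<phi> x) (\<phi> y)) \<and>
     (\<forall>x y. form M (\<phi> x) (\<phi> y) = form L x y)"

definition saa_isomorphic ::
  "('f::field, 'v::ab_group_add) saa \<Rightarrow> ('f, 'w::ab_group_add) saa \<Rightarrow> bool" where
  "saa_isomorphic L M \<longleftrightarrow> (\<exists>\<phi>. saa_iso L M \<phi>)"

definition subspace_mul ::
  "('f::field, 'v::ab_group_add) saa \<Rightarrow> 'v set \<Rightarrow> 'v set \<Rightarrow> 'v set" where
  "subspace_mul L U V = module.span (smul L) {mul L u v | u v. u \<in> U \<and> v \<in> V}"

text \<open>\<open>lower_power L k\<close> is \<open>L\<^sup>k\<close> for \<open>k \<ge> 1\<close>; the value at \<open>0\<close> is never used.\<close>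

fun lower_power :: "('f::field, 'v::ab_group_add) saa \<Rightarrow> nat \<Rightarrow> 'v set" where
  "lower_power L 0 = UNIV"
| "lower_power L (Suc 0) = UNIV"
| "lower_power L (Suc (Suc k)) = subspace_mul L (lower_power L (Suc k)) UNIV"

definition nilpotent :: "('f::field, 'v::ab_group_add) saa \<Rightarrow> bool" where
  "nilpotent L \<longleftrightarrow> (\<exists>k. lower_power L (k + 1) = {0})"

definition nilpotence_class :: "('f::field, 'v::ab_group_add) saa \<Rightarrow> nat" where
  "nilpotence_class L = (LEAST k. lower_power L (k + 1) = {0})"

definition center :: "('f::field, 'v::ab_group_add) saa \<Rightarrow> 'v set" where
  "center L = {z. \<forall>x. mul L z x = 0}"

definition isotropic :: "('f::field, 'v::ab_group_add) saa \<Rightarrow> 'v set \<Rightarrow> bool" where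
  "isotropic L U \<longleftrightarrow> (\<forall>u\<in>U. \<forall>v\<in>U. form L u v = 0)"

text \<open>Labels of the vectors \<open>x\<^sub>i\<close>, \<open>y\<^sub>i\<close> of a standard basis.\<close>

datatype label = X nat | Y nat

definition labels :: "nat \<Rightarrow> label set" where
  "labels n = X ` {1..n} \<union> Y ` {1..n}"

definition standard_basis ::
  "('f::field, 'v::ab_group_add) saa \<Rightarrow> nat \<Rightarrow> (label \<Rightarrow> 'v) \<Rightarrow> bool" where
  "standard_basis L n b \<longleftrightarrow>
     inj_on b (labels n) \<and>
     \<not> module.dependent (smul L) (b ` labels n) \<and>
     module.span (smul L) (b ` labels n) = UNIV \<and>
     (\<forall>i\<in>{1..n}. \<forall>j\<in>{1..n}.
        form L (b (X i)) (b (X j)) = 0 \<and>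
        form L (b (Y i)) (b (Y j)) = 0 \<and>
        form L (b (X i)) (b (Y j)) = (if i = j then 1 else 0))"

text \<open>An entry \<open>((u, v, w), c)\<close> of a presentation stands for \<open>(uv, w) = c\<close>. Every listed
  triple consists of three different labels, so the triples whose value follows from it by the
  alternating property are those with the same set of labels (and those with a
  repeated label, whose value is \<open>0\<close>).\<close>

type_synonym 'f presentation = "((label \<times> label \<times> label) \<times> 'f) set"

definition has_presentation ::
  "('f::field, 'v::ab_group_add) saa \<Rightarrow> nat \<Rightarrow> 'f presentation \<Rightarrow> bool" where
  "has_presentation L n P \<longleftrightarrow>
     (\<exists>b. standard_basis L n b \<and>
       (\<forall>u v w c. ((u, v, w), c) \<in> P \<longrightarrow> form L (mul L (b u) (b v)) (b w) = c) \<and>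
       (\<forall>u\<in>labels n. \<forall>v\<in>labels n. \<forall>w\<in>labels n.
          (\<nexists>u' v' w' c. ((u', v', w'), c) \<in> P \<and> {u, v, w} = {u', v', w'}) \<longrightarrow>
          form L (mul L (b u) (b v)) (b w) = 0))"

definition P10_2_2 :: "'f::field \<Rightarrow> 'f presentation" where
  "P10_2_2 r =
     {((X 3, Y 4, Y 5), r), ((X 2, Y 3, Y 5), 1), ((X 1, Y 3, Y 4), 1), ((Y 1, Y 2, Y 3), 1)}"

definition nonzero_powers :: "nat \<Rightarrow> 'f::field set" where
  "nonzero_powers m = {a ^ m | a. a \<noteq> 0}"

definition class6_properties :: "('f::field, 'v::ab_group_add) saa \<Rightarrow> bool" where
  "class6_properties L \<longleftrightarrow>
     nilpotent L \<and>
     vector_space.dim (smul L) (UNIV :: 'v set) = 10 \<and>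
     isotropic L (center L) \<and>
     vector_space.dim (smul L) (center L) = 2 \<and>
     nilpotence_class L = 6 \<and>
     \<not> subspace_mul L (lower_power L 3) (lower_power L 3) \<subseteq> center L"

end

theory Submission imports Defs begin

text \<open>
  For a standard basis, a presentation fixes the alternating trilinear form \<open>(uv, w)\<close> as a sum of
  \<open>3 \<times> 3\<close> determinants in the coordinates, from which the powers \<open>L\<^sup>k\<close>, the center and the effect of
  isomorphisms can be read off.

  Conversely, let \<open>L\<close> have the stated properties. Since \<open>(L\<^sup>i, L\<^sup>j) = (L, L\<^sup>i\<^sup>+\<^sup>j\<^sup>-\<^sup>1) = 0\<close> for
  \<open>i + j \<ge> 8\<close>, the subspace \<open>L\<^sup>4\<close> is isotropic and \<open>L\<^sup>3L\<^sup>4 = 0\<close>. As \<open>Z(L)\<close>, the orthogonal space of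
  \<open>L\<^sup>2\<close>, has dimension 2, \<open>L\<close> is generated modulo \<open>L\<^sup>2\<close> by two elements \<open>y\<^sub>4, y\<^sub>5\<close>. With \<open>y = y\<^sub>4y\<^sub>5\<close>,
  \<open>a = yy\<^sub>4\<close>, \<open>c = yy\<^sub>5\<close>, the condition on \<open>L\<^sup>3L\<^sup>3\<close> becomes \<open>t = (ac, y) \<noteq> 0\<close>. One can then change
  \<open>y\<^sub>4, y\<^sub>5\<close> so that \<open>(ac, y\<^sub>4) = (ac, y\<^sub>5) = (a, c) = 0\<close> and \<open>t = -r\<^sup>3\<close>. Up to scalars, \<open>a, c, y, y\<^sub>4, y\<^sub>5\<close>
  have \<open>cy, ya, ac, (ac)y\<^sub>5, (ac)y\<^sub>4 \<in> L\<^sup>4\<close> as dual vectors, and correcting the former by elements of \<open>L\<^sup>4\<close>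
  yields the standard basis.
\<close>



section \<open>Calculus of the form and the product, and orthogonality of subspaces\<close>

context symplectic_alternating_algebra
begin

abbreviation scal (infixr "\<odot>" 75) where "c \<odot> x \<equiv> smul L c x"
abbreviation product (infixl "\<bullet>" 70) where "x \<bullet> y \<equiv> mul L x y"
abbreviation pairing ("\<langle>_,_\<rangle>") where "\<langle>x,y\<rangle> \<equiv> form L x y"

lemma form_left_simps [simp]:
  "\<langle>x + y, z\<rangle> = \<langle>x,z\<rangle> + \<langle>y,z\<rangle>" "\<langle>c \<odot> x, z\<rangle> = c * \<langle>x,z\<rangle>" "\<langle>0,z\<rangle> = 0"
  "\<langle>- x,z\<rangle> = - \<langle>x,z\<rangle>" "\<langle>x - y, z\<rangle> = \<langle>x,z\<rangle> - \<langle>y,z\<rangle>" "\<langle>sum f A, z\<rangle> = (\<Sum>a\<in>A. \<langle>f a,z\<rangle>)"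
proof -
  interpret l: Vector_Spaces.linear "smul L" "(*)" "\<lambda>x. \<langle>x,z\<rangle>" by (rule form_linear_left)
  show "\<langle>x + y, z\<rangle> = \<langle>x,z\<rangle> + \<langle>y,z\<rangle>" "\<langle>c \<odot> x, z\<rangle> = c * \<langle>x,z\<rangle>" "\<langle>0,z\<rangle> = 0"
    "\<langle>- x,z\<rangle> = - \<langle>x,z\<rangle>" "\<langle>x - y, z\<rangle> = \<langle>x,z\<rangle> - \<langle>y,z\<rangle>" "\<langle>sum f A, z\<rangle> = (\<Sum>a\<in>A. \<langle>f a,z\<rangle>)"
    by (rule l.add l.scale l.zero l.neg l.diff l.sum)+
qed

lemma form_right_simps [simp]:
  "\<langle>z, x + y\<rangle> = \<langle>z,x\<rangle> + \<langle>z,y\<rangle>" "\<langle>z, c \<odot> x\<rangle> = c * \<langle>z,x\<rangle>" "\<langle>z,0\<rangle> = 0"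
  "\<langle>z, - x\<rangle> = - \<langle>z,x\<rangle>" "\<langle>z, x - y\<rangle> = \<langle>z,x\<rangle> - \<langle>z,y\<rangle>" "\<langle>z, sum f A\<rangle> = (\<Sum>a\<in>A. \<langle>z,f a\<rangle>)"
proof -
  interpret l: Vector_Spaces.linear "smul L" "(*)" "\<lambda>x. \<langle>z,x\<rangle>" by (rule form_linear_right)
  show "\<langle>z, x + y\<rangle> = \<langle>z,x\<rangle> + \<langle>z,y\<rangle>" "\<langle>z, c \<odot> x\<rangle> = c * \<langle>z,x\<rangle>" "\<langle>z,0\<rangle> = 0"
    "\<langle>z, - x\<rangle> = - \<langle>z,x\<rangle>" "\<langle>z, x - y\<rangle> = \<langle>z,x\<rangle> - \<langle>z,y\<rangle>" "\<langle>z, sum f A\<rangle> = (\<Sum>a\<in>A. \<langle>z,f a\<rangle>)"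
    by (rule l.add l.scale l.zero l.neg l.diff l.sum)+
qed

lemma mul_left_simps [simp]:
  "(x + y) \<bullet> z = x \<bullet> z + y \<bullet> z" "(c \<odot> x) \<bullet> z = c \<odot> (x \<bullet> z)" "0 \<bullet> z = 0"
  "(- x) \<bullet> z = - (x \<bullet> z)" "(x - y) \<bullet> z = x \<bullet> z - y \<bullet> z"
proof -
  interpret l: Vector_Spaces.linear "smul L" "smul L" "\<lambda>x. x \<bullet> z" by (rule mul_linear_left)
  show "(x + y) \<bullet> z = x \<bullet> z + y \<bullet> z" "(c \<odot> x) \<bullet> z = c \<odot> (x \<bullet> z)" "0 \<bullet> z = 0"
    "(- x) \<bullet> z = - (x \<bullet> z)" "(x - y) \<bullet> z = x \<bullet> z - y \<bullet> z"
    by (rule l.add l.scale l.zero l.neg l.diff)+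
qed

lemma mul_right_simps [simp]:
  "z \<bullet> (x + y) = z \<bullet> x + z \<bullet> y" "z \<bullet> (c \<odot> x) = c \<odot> (z \<bullet> x)" "z \<bullet> 0 = 0"
  "z \<bullet> (- x) = - (z \<bullet> x)" "z \<bullet> (x - y) = z \<bullet> x - z \<bullet> y"
proof -
  interpret l: Vector_Spaces.linear "smul L" "smul L" "\<lambda>x. z \<bullet> x" by (rule mul_linear_right)
  show "z \<bullet> (x + y) = z \<bullet> x + z \<bullet> y" "z \<bullet> (c \<odot> x) = c \<odot> (z \<bullet> x)" "z \<bullet> 0 = 0"
    "z \<bullet> (- x) = - (z \<bullet> x)" "z \<bullet> (x - y) = z \<bullet> x - z \<bullet> y"
    by (rule l.add l.scale l.zero l.neg l.diff)+
qed

declare form_alternating [simp] mul_alternating [simp]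

lemma form_swap: "\<langle>y,x\<rangle> = - \<langle>x,y\<rangle>"
proof -
  have "\<langle>x + y, x + y\<rangle> = 0" by (rule form_alternating)
  then have "\<langle>x,y\<rangle> + \<langle>y,x\<rangle> = 0" unfolding form_left_simps form_right_simps by (simp add: add.commute)
  then show ?thesis by (simp add: add_eq_0_iff)
qed

lemma mul_swap: "y \<bullet> x = - (x \<bullet> y)"
proof -
  have "(x + y) \<bullet> (x + y) = 0" by (rule mul_alternating)
  then have "x \<bullet> y + y \<bullet> x = 0" unfolding mul_left_simps mul_right_simps by (simp add: add.commute)
  then show ?thesis by (simp add: add_eq_0_iff)
qed

lemma triple_swap12: "\<langle>y \<bullet> x, z\<rangle> = - \<langle>x \<bullet> y, z\<rangle>"
  by (subst mul_swap) simp

lemma triple_swap23: "\<langle>x \<bullet> z, y\<rangle> = - \<langle>x \<bullet> y, z\<rangle>"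
  using form_mul_cyclic triple_swap12 by metis

lemma triple_repeat [simp]: "\<langle>x \<bullet> y, x\<rangle> = 0" "\<langle>x \<bullet> y, y\<rangle> = 0"
  using form_mul_cyclic[of x y x] form_mul_cyclic[of y x x] form_mul_cyclic[of x y y]
  by (simp_all only: form_left_simps mul_alternating)

lemma eq_if_form_eq: "(\<And>z. \<langle>x,z\<rangle> = \<langle>y,z\<rangle>) \<Longrightarrow> x = y"
  using form_nondegenerate[of "x - y"] by simp

text \<open>Induction on \<open>S\<close>, as in Gram-Schmidt: if \<open>s\<close> is new, take
  \<open>u0\<close> orthogonal to \<open>S\<close> and dual to \<open>s\<close>, separate
  \<open>v - \<langle>v,u0\<rangle> \<odot> s\<close> from \<open>S\<close> by \<open>u1\<close>,
  and make \<open>u1\<close> orthogonal to \<open>s\<close> by subtracting a multiple of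
  \<open>u0\<close>.\<close>

lemma exists_perp_separating:
  assumes "finite S" "v \<notin> span S"
  shows "\<exists>u. (\<forall>s\<in>S. \<langle>s,u\<rangle> = 0) \<and> \<langle>v,u\<rangle> = 1"
  using assms
proof (induction S arbitrary: v rule: finite_induct)
  case empty
  then have "v \<noteq> 0" by simp
  then obtain u where "\<langle>v,u\<rangle> \<noteq> 0" using form_nondegenerate by blast
  then show ?case by (intro exI[of _ "inverse \<langle>v,u\<rangle> \<odot> u"]) simp
next
  case (insert s S)
  show ?case
  proof (cases "s \<in> span S")
    case True
    then have "v \<notin> span S" using insert.prems span_redundant by metis
    then obtain u where u: "\<forall>s\<in>S. \<langle>s,u\<rangle> = 0" "\<langle>v,u\<rangle> = 1" using insert.IH by blast
    have "\<langle>s,u\<rangle> = 0"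
      using True by (induction rule: span_induct_alt) (use u in auto)
    then show ?thesis using u by blast
  next
    case False
    then obtain u0 where u0: "\<forall>s\<in>S. \<langle>s,u0\<rangle> = 0" "\<langle>s,u0\<rangle> = 1" using insert.IH by blast
    have "v - \<langle>v,u0\<rangle> \<odot> s \<notin> span S" using insert.prems span_breakdown_eq by blast
    then obtain u1 where u1: "\<forall>s\<in>S. \<langle>s,u1\<rangle> = 0" "\<langle>v - \<langle>v,u0\<rangle> \<odot> s,u1\<rangle> = 1"
      using insert.IH by blast
    show ?thesis
      by (rule exI[of _ "u1 - \<langle>s,u1\<rangle> \<odot> u0"]) (use u0 u1 in \<open>auto simp: algebra_simps\<close>)
  qed
qed

lemma subspace_finite_span:
  assumes "subspace W"
  shows "\<exists>S. finite S \<and> span S = W"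
proof -
  obtain B where B: "finite B" "span B = UNIV" using finite_dim by auto
  obtain S where S: "S \<subseteq> W" "independent S" "W \<subseteq> span S" by (rule basis_exists[of W])
  have "finite S" using independent_span_bound[OF B(1) S(2)] B(2) by auto
  moreover have "span S = W" using S assms span_minimal by blast
  ultimately show ?thesis by blast
qed

text \<open>The double orthogonal of a subspace is the subspace itself. This turns knowledge of the
  center, the orthogonal space of \<open>L\<^sup>2\<close>, into membership in
  \<open>L\<^sup>2\<close>.\<close>

lemma subspace_eq_perp_perp:
  assumes "subspace W" "\<And>u. (\<And>w. w \<in> W \<Longrightarrow> \<langle>w,u\<rangle> = 0) \<Longrightarrow> \<langle>v,u\<rangle> = 0"
  shows "v \<in> W"
proof (rule ccontr)
  assume v: "v \<notin> W"
  obtain S where S: "finite S" "span S = W" using subspace_finite_span[OF assms(1)] by blast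
  then obtain u where u: "\<forall>s\<in>S. \<langle>s,u\<rangle> = 0" "\<langle>v,u\<rangle> = 1" using exists_perp_separating v by blast
  have "\<langle>w,u\<rangle> = 0" if "w \<in> W" for w
    using that[folded S(2)] by (induction rule: span_induct_alt) (use u in auto)
  then have "\<langle>v,u\<rangle> = 0" by (rule assms(2))
  then show False using u by simp
qed

end


subsection \<open>Coordinates and presentations\<close>

lemma finite_labels [simp]: "finite (labels n)"
  by (simp add: labels_def)

lemma card_labels: "card (labels n) = 2 * n"
  by (subst labels_def, subst card_Un_disjoint) (auto simp: card_image inj_on_def)

lemma labels_5:
  "labels 5 = {X 1, X 2, X 3, X 4, X 5, Y 1, Y 2, Y 3, Y 4, Y 5}"
proof -
  have "{1..5::nat} = {1,2,3,4,5}" by auto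
  then show ?thesis by (auto simp: labels_def)
qed

text \<open>The wedge product of three functionals, expanded along the row of
  \<open>f\<close>.\<close>

definition det3 :: "('a \<Rightarrow> 'f::comm_ring_1) \<Rightarrow> ('a \<Rightarrow> 'f) \<Rightarrow> ('a \<Rightarrow> 'f) \<Rightarrow> 'a \<Rightarrow> 'a \<Rightarrow> 'a \<Rightarrow> 'f" where
  "det3 f g h u v w =
     f u * (g v * h w - g w * h v) - f v * (g u * h w - g w * h u) + f w * (g u * h v - g v * h u)"

text \<open>For the coordinates \<open>k\<close> with respect to a standard basis, this is the alternating trilinear
  form with the values prescribed by \<open>P10_2_2 r\<close>.\<close>

definition presentation_form :: "(label \<Rightarrow> 'a \<Rightarrow> 'f::comm_ring_1) \<Rightarrow> 'f \<Rightarrow> 'a \<Rightarrow> 'a \<Rightarrow> 'a \<Rightarrow> 'f" where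
  "presentation_form k r u v w =
     r * det3 (k (X 3)) (k (Y 4)) (k (Y 5)) u v w + det3 (k (X 2)) (k (Y 3)) (k (Y 5)) u v w +
     det3 (k (X 1)) (k (Y 3)) (k (Y 4)) u v w + det3 (k (Y 1)) (k (Y 2)) (k (Y 3)) u v w"

lemma presentation_form_alternating:
  "presentation_form k r v u w = - presentation_form k r u v w"
  "presentation_form k r v w u = presentation_form k r u v w"
  "presentation_form k r u u w = 0"
  unfolding presentation_form_def det3_def by (simp_all add: algebra_simps)

text \<open>The coordinates of basis vectors, seen on labels alone:
  \<open>presentation_form label_delta r\<close> lists the prescribed values before any basis is
  given.\<close>

definition label_delta :: "label \<Rightarrow> label \<Rightarrow> 'f::zero_neq_one" where
  "label_delta l m = (if m = l then 1 else 0)"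

text \<open>A label in only one of the two sets makes a row or a column of the determinant
  zero.\<close>

lemma det3_label_delta_eq_0:
  assumes "{u, v, w} \<noteq> {l, m, n}"
  shows "det3 (label_delta l) (label_delta m) (label_delta n) u v w = 0"
  using assms by (auto simp: det3_def label_delta_def split: if_splits)

lemma P10_2_2_covers_iff:
  "(\<exists>u v w c. ((u, v, w), c) \<in> P10_2_2 r \<and> S = {u, v, w}) \<longleftrightarrow>
     S = {X 3, Y 4, Y 5} \<or> S = {X 2, Y 3, Y 5} \<or> S = {X 1, Y 3, Y 4} \<or> S = {Y 1, Y 2, Y 3}"
  by (simp add: P10_2_2_def conj_disj_distribR ex_disj_distrib)

context symplectic_alternating_algebra
begin

definition symplectic_family :: "nat \<Rightarrow> (label \<Rightarrow> 'v) \<Rightarrow> bool" where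
  "symplectic_family n b \<longleftrightarrow> (\<forall>i\<in>{1..n}. \<forall>j\<in>{1..n}.
     \<langle>b (X i), b (X j)\<rangle> = 0 \<and> \<langle>b (Y i), b (Y j)\<rangle> = 0 \<and>
     \<langle>b (X i), b (Y j)\<rangle> = (if i = j then 1 else 0))"

text \<open>The coefficient of a basis vector is the pairing with its dual partner. The argument
  order depends on the kind of label so that no sign appears.\<close>

primrec coord :: "(label \<Rightarrow> 'v) \<Rightarrow> label \<Rightarrow> 'v \<Rightarrow> 'f" where
  "coord b (X i) = (\<lambda>u. \<langle>u, b (Y i)\<rangle>)"
| "coord b (Y i) = (\<lambda>u. \<langle>b (X i), u\<rangle>)"

lemma coord_simps [simp]:
  "coord b l (u + v) = coord b l u + coord b l v" "coord b l (c \<odot> u) = c * coord b l u"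
  "coord b l 0 = 0" "coord b l (- u) = - coord b l u" "coord b l (u - v) = coord b l u - coord b l v"
  "coord b l (sum f A) = (\<Sum>a\<in>A. coord b l (f a))"
  by (cases l; simp)+

lemma coord_basis:
  assumes "symplectic_family n b" "l \<in> labels n" "m \<in> labels n"
  shows "coord b l (b m) = (if m = l then 1 else 0)"
  using assms by (auto simp: labels_def symplectic_family_def; simp split: if_splits)

lemma coord_combination:
  assumes "symplectic_family n b" "l \<in> labels n"
  shows "coord b l (\<Sum>m\<in>labels n. c m \<odot> b m) = c l"
proof -
  have "coord b l (\<Sum>m\<in>labels n. c m \<odot> b m) = (\<Sum>m\<in>labels n. c m * (if m = l then 1 else 0))"
    using assms by (simp add: coord_basis)
  then show ?thesis using assms by (simp add: if_distrib cong: if_cong)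
qed

lemma symplectic_family_inj:
  assumes "symplectic_family n b"
  shows "inj_on b (labels n)"
proof (rule inj_onI)
  fix l m assume "l \<in> labels n" "m \<in> labels n" "b l = b m"
  then show "l = m" using coord_basis[OF assms, of l] by (metis zero_neq_one)
qed

lemma symplectic_family_independent:
  assumes "symplectic_family n b"
  shows "independent (b ` labels n)"
proof
  assume "dependent (b ` labels n)"
  then obtain c v where c: "v \<in> b ` labels n" "c v \<noteq> 0" "(\<Sum>v\<in>b ` labels n. c v \<odot> v) = 0"
    by (auto simp: dependent_finite)
  then obtain l where l: "l \<in> labels n" "v = b l" by auto
  have "(\<Sum>m\<in>labels n. c (b m) \<odot> b m) = 0"
    using c(3) sum.reindex[OF symplectic_family_inj[OF assms], of "\<lambda>v. c v \<odot> v"] by simp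
  then have "c (b l) = 0" using coord_combination[OF assms l(1), of "\<lambda>m. c (b m)"] by simp
  then show False using c l by simp
qed

lemma standard_basis_iff:
  "standard_basis L n b \<longleftrightarrow> symplectic_family n b \<and> span (b ` labels n) = UNIV"
  using symplectic_family_inj symplectic_family_independent
  unfolding standard_basis_def symplectic_family_def by blast

lemma standard_basis_if_dim:
  assumes "symplectic_family n b" "dim (UNIV :: 'v set) = 2 * n"
  shows "standard_basis L n b"
proof -
  obtain B0 where B0: "finite B0" "span B0 = UNIV" using finite_dim by auto
  obtain B where B: "B \<subseteq> B0" "independent B" "B0 \<subseteq> span B" by (rule basis_exists[of B0])
  have "span B = UNIV" using B B0 by (metis span_mono span_span top.extremum_uniqueI)
  then interpret finite_dimensional_vector_space "smul L" B
    using B B0 finite_subset by unfold_locales auto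
  have "card (b ` labels n) = dim (UNIV :: 'v set)"
    using symplectic_family_inj[OF assms(1)] assms(2) by (simp add: card_image card_labels)
  then have "span (b ` labels n) = UNIV"
    using card_ge_dim_independent[of "b ` labels n" UNIV] symplectic_family_independent[OF assms(1)]
    by (metis order_refl subset_UNIV top.extremum_uniqueI)
  then show ?thesis using assms(1) by (simp add: standard_basis_iff)
qed

lemma standard_basis_dim:
  assumes "standard_basis L n b"
  shows "dim (UNIV :: 'v set) = 2 * n"
proof -
  have "dim (UNIV :: 'v set) = card (b ` labels n)"
    using assms unfolding standard_basis_def by (intro dim_unique) auto
  then show ?thesis using assms by (simp add: standard_basis_def card_image card_labels)
qed

text \<open>Up to sign, coordinates are pairings with the basis vectors. These span, so
  nondegeneracy gives equality.\<close>

lemma standard_basis_eqI: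
  assumes "standard_basis L n b" "\<And>l. l \<in> labels n \<Longrightarrow> coord b l u = coord b l v"
  shows "u = v"
proof (rule eq_if_form_eq)
  fix z
  have z: "z \<in> span (b ` labels n)" using assms(1) by (simp add: standard_basis_iff)
  show "\<langle>u,z\<rangle> = \<langle>v,z\<rangle>"
    using z
  proof (induction rule: span_induct_alt)
    case (step c x y)
    then obtain l where l: "l \<in> labels n" "x = b l" by auto
    have "\<langle>u,x\<rangle> = \<langle>v,x\<rangle>"
    proof (cases l)
      case (X i)
      then have "coord b (Y i) u = coord b (Y i) v" using l by (intro assms(2)) (auto simp: labels_def)
      then show ?thesis using X l form_swap[of u] form_swap[of v] by simp
    next
      case (Y i)
      then have "coord b (X i) u = coord b (X i) v" using l by (intro assms(2)) (auto simp: labels_def)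
      then show ?thesis using Y l by simp
    qed
    then show ?case using step by simp
  qed simp
qed

lemma standard_basis_expand:
  assumes "standard_basis L n b"
  shows "u = (\<Sum>l\<in>labels n. coord b l u \<odot> b l)"
  by (rule standard_basis_eqI[OF assms])
    (use assms in \<open>simp add: standard_basis_iff coord_combination del: coord_simps(6)\<close>)

lemma linear_eq_on_standard_basis:
  fixes f g :: "'v \<Rightarrow> 'f"
  assumes "standard_basis L n b" "\<And>l. l \<in> labels n \<Longrightarrow> f (b l) = g (b l)"
    "\<And>x y. f (x + y) = f x + f y" "\<And>c x. f (c \<odot> x) = c * f x"
    "\<And>x y. g (x + y) = g x + g y" "\<And>c x. g (c \<odot> x) = c * g x"
  shows "f u = g u"
proof -
  have "u \<in> span (b ` labels n)" using assms(1) by (simp add: standard_basis_iff)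
  then show ?thesis
  proof (induction rule: span_induct_alt)
    case base
    then show ?case using assms(4)[of 0 0] assms(6)[of 0 0] by simp
  next
    case (step c x y)
    then show ?case using assms(2-) by auto
  qed
qed

lemma presentation_form_linear:
  "presentation_form (coord b) r (x + y) v w =
     presentation_form (coord b) r x v w + presentation_form (coord b) r y v w"
  "presentation_form (coord b) r v (x + y) w =
     presentation_form (coord b) r v x w + presentation_form (coord b) r v y w"
  "presentation_form (coord b) r v w (x + y) =
     presentation_form (coord b) r v w x + presentation_form (coord b) r v w y"
  "presentation_form (coord b) r (c \<odot> x) v w = c * presentation_form (coord b) r x v w"
  "presentation_form (coord b) r v (c \<odot> x) w = c * presentation_form (coord b) r v x w"
  "presentation_form (coord b) r v w (c \<odot> x) = c * presentation_form (coord b) r v w x"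
  unfolding presentation_form_def det3_def coord_simps by algebra+

text \<open>Both sides are trilinear, so agreement on basis vectors extends to all vectors, one
  argument at a time from the last to the first.\<close>

lemma triple_eq_presentation_form:
  assumes b: "standard_basis L 5 b"
    and T: "\<And>l m n. \<lbrakk>l \<in> labels 5; m \<in> labels 5; n \<in> labels 5\<rbrakk> \<Longrightarrow>
      \<langle>b l \<bullet> b m, b n\<rangle> = presentation_form label_delta r l m n"
  shows "\<langle>u \<bullet> v, w\<rangle> = presentation_form (coord b) r u v w"
proof -
  have fam: "symplectic_family 5 b" using b by (simp add: standard_basis_iff)
  have 0: "\<langle>b l \<bullet> b m, b n\<rangle> = presentation_form (coord b) r (b l) (b m) (b n)"
    if "l \<in> labels 5" "m \<in> labels 5" "n \<in> labels 5" for l m n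
  proof -
    have "coord b k (b j) = label_delta k j" if "k \<in> labels 5" "j \<in> labels 5" for k j
      using coord_basis[OF fam that] by (simp add: label_delta_def)
    moreover have "X 1 \<in> labels 5" "X 2 \<in> labels 5" "X 3 \<in> labels 5" "Y 1 \<in> labels 5"
      "Y 2 \<in> labels 5" "Y 3 \<in> labels 5" "Y 4 \<in> labels 5" "Y 5 \<in> labels 5"
      by (simp_all add: labels_5)
    ultimately have "presentation_form (coord b) r (b l) (b m) (b n) =
        presentation_form label_delta r l m n"
      using that by (simp only: presentation_form_def det3_def)
    then show ?thesis using T[OF that] by simp
  qed
  have 1: "\<langle>b l \<bullet> b m, w\<rangle> = presentation_form (coord b) r (b l) (b m) w"
    if "l \<in> labels 5" "m \<in> labels 5" for l m w
    by (rule linear_eq_on_standard_basis[OF b, where f = "\<lambda>w. \<langle>b l \<bullet> b m, w\<rangle>"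
          and g = "presentation_form (coord b) r (b l) (b m)"])
      (simp_all add: 0 that presentation_form_linear)
  have 2: "\<langle>b l \<bullet> v, w\<rangle> = presentation_form (coord b) r (b l) v w" if "l \<in> labels 5" for l v w
    by (rule linear_eq_on_standard_basis[OF b, where f = "\<lambda>v. \<langle>b l \<bullet> v, w\<rangle>"
          and g = "\<lambda>v. presentation_form (coord b) r (b l) v w"])
      (simp_all add: 1 that presentation_form_linear)
  show ?thesis
    by (rule linear_eq_on_standard_basis[OF b, where f = "\<lambda>u. \<langle>u \<bullet> v, w\<rangle>"
          and g = "\<lambda>u. presentation_form (coord b) r u v w"])
      (simp_all add: 2 presentation_form_linear)
qed

text \<open>Replaces the table of values by one polynomial identity in the coordinates, from which
  all later computations start.\<close>

lemma has_presentation_iff: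
  "has_presentation L 5 (P10_2_2 r) \<longleftrightarrow>
     (\<exists>b. standard_basis L 5 b \<and> (\<forall>u v w. \<langle>u \<bullet> v, w\<rangle> = presentation_form (coord b) r u v w))"
  (is "_ \<longleftrightarrow> (\<exists>b. _ \<and> ?T b)")
proof -
  let ?P = "\<lambda>b. (\<forall>u v w c. ((u, v, w), c) \<in> P10_2_2 r \<longrightarrow> \<langle>b u \<bullet> b v, b w\<rangle> = c) \<and>
       (\<forall>u\<in>labels 5. \<forall>v\<in>labels 5. \<forall>w\<in>labels 5.
          (\<nexists>u' v' w' c. ((u', v', w'), c) \<in> P10_2_2 r \<and> {u, v, w} = {u', v', w'}) \<longrightarrow>
          \<langle>b u \<bullet> b v, b w\<rangle> = 0)"
  have PT: "?T b" if b: "standard_basis L 5 b" and P: "?P b" for b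
  proof -
    have T: "\<langle>b l \<bullet> b m, b n\<rangle> = presentation_form label_delta r l m n"
      if lab: "l \<in> labels 5" "m \<in> labels 5" "n \<in> labels 5" for l m n
    proof -
      have main: "\<langle>b (X 3) \<bullet> b (Y 4), b (Y 5)\<rangle> = r" "\<langle>b (X 2) \<bullet> b (Y 3), b (Y 5)\<rangle> = 1"
        "\<langle>b (X 1) \<bullet> b (Y 3), b (Y 4)\<rangle> = 1" "\<langle>b (Y 1) \<bullet> b (Y 2), b (Y 3)\<rangle> = 1"
        using conjunct1[OF P] unfolding P10_2_2_def by blast+
      \<comment> \<open>A rearranged listed triple acquires the sign of the permutation, which is
        also the value of the determinant of \<open>label_delta\<close>s. The four listed label sets
        differ, so only one determinant survives in each case below.\<close>
      have perm: "\<langle>b l \<bullet> b m, b n\<rangle> = det3 (label_delta p) (label_delta q) (label_delta s) l m n * c"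
        if "{l, m, n} = {p, q, s}" "\<langle>b p \<bullet> b q, b s\<rangle> = c" "p \<noteq> q" "p \<noteq> s" "q \<noteq> s" for p q s c
      proof -
        have "(l = p \<and> m = q \<and> n = s) \<or> (l = p \<and> m = s \<and> n = q) \<or> (l = q \<and> m = p \<and> n = s) \<or>
            (l = q \<and> m = s \<and> n = p) \<or> (l = s \<and> m = p \<and> n = q) \<or> (l = s \<and> m = q \<and> n = p)"
        proof -
          have "l \<in> {p, q, s}" "m \<in> {p, q, s}" "n \<in> {p, q, s}"
            using that(1) by blast+
          moreover have "p = l \<or> p = m \<or> p = n" "q = l \<or> q = m \<or> q = n" "s = l \<or> s = m \<or> s = n"
            using that(1) by blast+
          ultimately show ?thesis using that(3-5) by (elim insertE emptyE) simp_all
        qed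
        moreover have "\<langle>b p \<bullet> b s, b q\<rangle> = - c" "\<langle>b q \<bullet> b p, b s\<rangle> = - c" "\<langle>b s \<bullet> b q, b p\<rangle> = - c"
          "\<langle>b q \<bullet> b s, b p\<rangle> = c" "\<langle>b s \<bullet> b p, b q\<rangle> = c"
          using that(2) triple_swap12 triple_swap23 form_mul_cyclic by metis+
        ultimately show ?thesis
          using that(2-5) not_sym[OF that(3)] not_sym[OF that(4)] not_sym[OF that(5)]
          by (elim disjE) (simp_all add: det3_def label_delta_def)
      qed
      consider "{l, m, n} = {X 3, Y 4, Y 5}" | "{l, m, n} = {X 2, Y 3, Y 5}"
        | "{l, m, n} = {X 1, Y 3, Y 4}" | "{l, m, n} = {Y 1, Y 2, Y 3}"
        | "{l, m, n} \<noteq> {X 3, Y 4, Y 5}" "{l, m, n} \<noteq> {X 2, Y 3, Y 5}"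
          "{l, m, n} \<noteq> {X 1, Y 3, Y 4}" "{l, m, n} \<noteq> {Y 1, Y 2, Y 3}"
        by argo
      then show ?thesis
      proof cases
        case 1
        moreover have "{l, m, n} \<noteq> {X 2, Y 3, Y 5}" "{l, m, n} \<noteq> {X 1, Y 3, Y 4}"
          "{l, m, n} \<noteq> {Y 1, Y 2, Y 3}" unfolding 1 by (simp_all add: set_eq_subset)
        ultimately show ?thesis using perm[OF 1 main(1)]
          by (simp add: presentation_form_def det3_label_delta_eq_0)
      next
        case 2
        moreover have "{l, m, n} \<noteq> {X 3, Y 4, Y 5}" "{l, m, n} \<noteq> {X 1, Y 3, Y 4}"
          "{l, m, n} \<noteq> {Y 1, Y 2, Y 3}" unfolding 2 by (simp_all add: set_eq_subset)
        ultimately show ?thesis using perm[OF 2 main(2)]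
          by (simp add: presentation_form_def det3_label_delta_eq_0)
      next
        case 3
        moreover have "{l, m, n} \<noteq> {X 3, Y 4, Y 5}" "{l, m, n} \<noteq> {X 2, Y 3, Y 5}"
          "{l, m, n} \<noteq> {Y 1, Y 2, Y 3}" unfolding 3 by (simp_all add: set_eq_subset)
        ultimately show ?thesis using perm[OF 3 main(3)]
          by (simp add: presentation_form_def det3_label_delta_eq_0)
      next
        case 4
        moreover have "{l, m, n} \<noteq> {X 3, Y 4, Y 5}" "{l, m, n} \<noteq> {X 2, Y 3, Y 5}"
          "{l, m, n} \<noteq> {X 1, Y 3, Y 4}" unfolding 4 by (simp_all add: set_eq_subset)
        ultimately show ?thesis using perm[OF 4 main(4)]
          by (simp add: presentation_form_def det3_label_delta_eq_0)
      next
        case 5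
        then have "\<nexists>u' v' w' c. ((u', v', w'), c) \<in> P10_2_2 r \<and> {l, m, n} = {u', v', w'}"
          unfolding P10_2_2_covers_iff by blast
        then have "\<langle>b l \<bullet> b m, b n\<rangle> = 0" using P lab by blast
        then show ?thesis using 5 by (simp add: presentation_form_def det3_label_delta_eq_0)
      qed
    qed
    show ?thesis using triple_eq_presentation_form[OF b T] by blast
  qed
  have TP: "?P b" if b: "standard_basis L 5 b" and T: "?T b" for b
  proof -
    have fam: "symplectic_family 5 b" using b by (simp add: standard_basis_iff)
    have c: "coord b k (b j) = label_delta k j" if "k \<in> labels 5" "j \<in> labels 5" for k j
      using coord_basis[OF fam that] by (simp add: label_delta_def)
    have lab: "X 1 \<in> labels 5" "X 2 \<in> labels 5" "X 3 \<in> labels 5" "Y 1 \<in> labels 5"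
      "Y 2 \<in> labels 5" "Y 3 \<in> labels 5" "Y 4 \<in> labels 5" "Y 5 \<in> labels 5"
      by (simp_all add: labels_5)
    have T': "\<langle>b l \<bullet> b m, b n\<rangle> = presentation_form label_delta r l m n"
      if "l \<in> labels 5" "m \<in> labels 5" "n \<in> labels 5" for l m n
      using T c lab that by (simp only: presentation_form_def det3_def)
    have h1: "\<langle>b u \<bullet> b v, b w\<rangle> = c" if "((u, v, w), c) \<in> P10_2_2 r" for u v w c
      using that lab by (auto simp: P10_2_2_def T' presentation_form_def det3_def label_delta_def)
    have h2: "\<langle>b u \<bullet> b v, b w\<rangle> = 0" if "u \<in> labels 5" "v \<in> labels 5" "w \<in> labels 5"
      "\<nexists>u' v' w' c. ((u', v', w'), c) \<in> P10_2_2 r \<and> {u, v, w} = {u', v', w'}" for u v w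
    proof -
      have "{u, v, w} \<noteq> {X 3, Y 4, Y 5}" "{u, v, w} \<noteq> {X 2, Y 3, Y 5}"
        "{u, v, w} \<noteq> {X 1, Y 3, Y 4}" "{u, v, w} \<noteq> {Y 1, Y 2, Y 3}"
        using that(4) unfolding P10_2_2_covers_iff by blast+
      then show ?thesis using that by (simp add: T' presentation_form_def det3_label_delta_eq_0)
    qed
    show ?thesis by (intro conjI allI ballI impI) (erule h1, rule h2)
  qed
  show ?thesis
    unfolding has_presentation_def
    by (intro iff_exI conj_cong refl iffI) (rule PT TP; assumption)+
qed

end


section \<open>Products of subspaces and monotonicity of the lower central series\<close>

context symplectic_alternating_algebra
begin

lemma subspace_mul_subset:
  assumes "subspace W" "\<And>u v. u \<in> U \<Longrightarrow> v \<in> V \<Longrightarrow> u \<bullet> v \<in> W"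
  shows "subspace_mul L U V \<subseteq> W"
  unfolding subspace_mul_def using assms by (intro span_minimal) auto

lemma mul_in_subspace_mul: "u \<in> U \<Longrightarrow> v \<in> V \<Longrightarrow> u \<bullet> v \<in> subspace_mul L U V"
  unfolding subspace_mul_def by (intro span_base) auto

lemma lower_power_Suc:
  "0 < k \<Longrightarrow> lower_power L (Suc k) = subspace_mul L (lower_power L k) UNIV"
  by (cases k) auto

lemma subspace_lower_power: "subspace (lower_power L k)"
proof (cases k)
  case (Suc j)
  then show ?thesis by (cases j) (auto simp: subspace_mul_def)
qed simp

lemma mul_in_lower_power: "u \<in> lower_power L k \<Longrightarrow> u \<bullet> v \<in> lower_power L (Suc k)"
  by (cases k) (auto intro: mul_in_subspace_mul)

lemma lower_power_Suc_subset: "lower_power L (Suc k) \<subseteq> lower_power L k"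
proof (induction k)
  case (Suc k)
  show ?case
    unfolding lower_power.simps
    using Suc.IH by (intro subspace_mul_subset subspace_lower_power mul_in_lower_power) auto
qed simp

lemma lower_power_antimono: "i \<le> j \<Longrightarrow> lower_power L j \<subseteq> lower_power L i"
  by (rule lift_Suc_antimono_le[of "lower_power L", OF lower_power_Suc_subset])

end

subsection \<open>Algebras with a given presentation\<close>

locale presented_algebra = symplectic_alternating_algebra L
  for L :: "('f::field, 'v::ab_group_add) saa" +
  fixes b :: "label \<Rightarrow> 'v" and r :: 'f
  assumes standard: "standard_basis L 5 b"
    and triple: "\<langle>u \<bullet> v, w\<rangle> = presentation_form (coord b) r u v w"
    and parameter_nonzero: "r \<noteq> 0"
begin

declare coord.simps [simp del] One_nat_def [simp del]

lemma coord_b [simp]: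
  "l \<in> {X 1, X 2, X 3, X 4, X 5, Y 1, Y 2, Y 3, Y 4, Y 5} \<Longrightarrow>
   m \<in> {X 1, X 2, X 3, X 4, X 5, Y 1, Y 2, Y 3, Y 4, Y 5} \<Longrightarrow>
   coord b l (b m) = (if m = l then 1 else 0)"
  using coord_basis[of 5 b l m] standard by (simp only: standard_basis_iff labels_5)

lemma eq_if_coords_eq:
  assumes "coord b (X 1) u = coord b (X 1) v" "coord b (X 2) u = coord b (X 2) v"
    "coord b (X 3) u = coord b (X 3) v" "coord b (X 4) u = coord b (X 4) v"
    "coord b (X 5) u = coord b (X 5) v" "coord b (Y 1) u = coord b (Y 1) v"
    "coord b (Y 2) u = coord b (Y 2) v" "coord b (Y 3) u = coord b (Y 3) v"
    "coord b (Y 4) u = coord b (Y 4) v" "coord b (Y 5) u = coord b (Y 5) v"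
  shows "u = v"
  by (rule standard_basis_eqI[OF standard]) (use assms in \<open>auto simp: labels_5\<close>)

text \<open>The coordinate of \<open>uv\<close> at \<open>X i\<close> is
  \<open>(uv, y\<^sub>i)\<close>, the one at \<open>Y i\<close> is \<open>-(uv, x\<^sub>i)\<close>.
  The last two vanish because no listed triple contains \<open>X 4\<close> or
  \<open>X 5\<close>.\<close>

lemma coord_mul:
  "coord b (X 1) (u \<bullet> v) = coord b (Y 2) u * coord b (Y 3) v - coord b (Y 3) u * coord b (Y 2) v"
  "coord b (X 2) (u \<bullet> v) = coord b (Y 3) u * coord b (Y 1) v - coord b (Y 1) u * coord b (Y 3) v"
  "coord b (X 3) (u \<bullet> v) = coord b (Y 1) u * coord b (Y 2) v - coord b (Y 2) u * coord b (Y 1) v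
     - (coord b (X 2) u * coord b (Y 5) v - coord b (Y 5) u * coord b (X 2) v)
     - (coord b (X 1) u * coord b (Y 4) v - coord b (Y 4) u * coord b (X 1) v)"
  "coord b (X 4) (u \<bullet> v) = - r * (coord b (X 3) u * coord b (Y 5) v - coord b (Y 5) u * coord b (X 3) v)
     + (coord b (X 1) u * coord b (Y 3) v - coord b (Y 3) u * coord b (X 1) v)"
  "coord b (X 5) (u \<bullet> v) = r * (coord b (X 3) u * coord b (Y 4) v - coord b (Y 4) u * coord b (X 3) v)
     + (coord b (X 2) u * coord b (Y 3) v - coord b (Y 3) u * coord b (X 2) v)"
  "coord b (Y 1) (u \<bullet> v) = - (coord b (Y 3) u * coord b (Y 4) v - coord b (Y 4) u * coord b (Y 3) v)"
  "coord b (Y 2) (u \<bullet> v) = - (coord b (Y 3) u * coord b (Y 5) v - coord b (Y 5) u * coord b (Y 3) v)"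
  "coord b (Y 3) (u \<bullet> v) = - r * (coord b (Y 4) u * coord b (Y 5) v - coord b (Y 5) u * coord b (Y 4) v)"
  "coord b (Y 4) (u \<bullet> v) = 0"
  "coord b (Y 5) (u \<bullet> v) = 0"
proof -
  have "coord b (X i) (u \<bullet> v) = presentation_form (coord b) r u v (b (Y i))"
    "coord b (Y i) (u \<bullet> v) = - presentation_form (coord b) r u v (b (X i))" for i
    using triple form_swap[of "u \<bullet> v"] by (simp_all add: coord.simps)
  note * = this[unfolded presentation_form_def det3_def]
  show "coord b (X 1) (u \<bullet> v) = coord b (Y 2) u * coord b (Y 3) v - coord b (Y 3) u * coord b (Y 2) v"
  "coord b (X 2) (u \<bullet> v) = coord b (Y 3) u * coord b (Y 1) v - coord b (Y 1) u * coord b (Y 3) v"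
  "coord b (X 3) (u \<bullet> v) = coord b (Y 1) u * coord b (Y 2) v - coord b (Y 2) u * coord b (Y 1) v
     - (coord b (X 2) u * coord b (Y 5) v - coord b (Y 5) u * coord b (X 2) v)
     - (coord b (X 1) u * coord b (Y 4) v - coord b (Y 4) u * coord b (X 1) v)"
  "coord b (X 4) (u \<bullet> v) = - r * (coord b (X 3) u * coord b (Y 5) v - coord b (Y 5) u * coord b (X 3) v)
     + (coord b (X 1) u * coord b (Y 3) v - coord b (Y 3) u * coord b (X 1) v)"
  "coord b (X 5) (u \<bullet> v) = r * (coord b (X 3) u * coord b (Y 4) v - coord b (Y 4) u * coord b (X 3) v)
     + (coord b (X 2) u * coord b (Y 3) v - coord b (Y 3) u * coord b (X 2) v)"
  "coord b (Y 1) (u \<bullet> v) = - (coord b (Y 3) u * coord b (Y 4) v - coord b (Y 4) u * coord b (Y 3) v)"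
  "coord b (Y 2) (u \<bullet> v) = - (coord b (Y 3) u * coord b (Y 5) v - coord b (Y 5) u * coord b (Y 3) v)"
  "coord b (Y 3) (u \<bullet> v) = - r * (coord b (Y 4) u * coord b (Y 5) v - coord b (Y 5) u * coord b (Y 4) v)"
  "coord b (Y 4) (u \<bullet> v) = 0"
  "coord b (Y 5) (u \<bullet> v) = 0"
    unfolding * by (simp_all add: algebra_simps)
qed

lemma basis_products:
  "b (Y 4) \<bullet> b (Y 5) = - r \<odot> b (Y 3)" "b (Y 3) \<bullet> b (Y 4) = - b (Y 1)"
  "b (Y 3) \<bullet> b (Y 5) = - b (Y 2)" "b (Y 1) \<bullet> b (Y 2) = b (X 3)" "b (Y 2) \<bullet> b (Y 3) = b (X 1)"
  "b (X 1) \<bullet> b (Y 4) = - b (X 3)" "b (X 3) \<bullet> b (Y 4) = r \<odot> b (X 5)"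
  by (rule eq_if_coords_eq; simp add: coord_mul)+

lemma form_eq_coords:
  "\<langle>u, v\<rangle> = coord b (X 1) u * coord b (Y 1) v - coord b (Y 1) u * coord b (X 1) v
     + coord b (X 2) u * coord b (Y 2) v - coord b (Y 2) u * coord b (X 2) v
     + coord b (X 3) u * coord b (Y 3) v - coord b (Y 3) u * coord b (X 3) v
     + coord b (X 4) u * coord b (Y 4) v - coord b (Y 4) u * coord b (X 4) v
     + coord b (X 5) u * coord b (Y 5) v - coord b (Y 5) u * coord b (X 5) v"
proof -
  have *: "\<langle>b (X i), v\<rangle> = coord b (Y i) v" "\<langle>b (Y i), v\<rangle> = - coord b (X i) v" for i
    using form_swap[of v] by (simp_all add: coord.simps)
  show ?thesis
    by (subst standard_basis_expand[OF standard, of u]) (simp add: labels_5 *)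
qed

lemma center_coords:
  assumes "z \<in> center L"
  shows "z = coord b (X 4) z \<odot> b (X 4) + coord b (X 5) z \<odot> b (X 5)"
proof -
  have "coord b l (z \<bullet> v) = 0" for l v using assms by (simp add: center_def)
  \<comment> \<open>Up to a factor \<open>1\<close>, \<open>-1\<close> or \<open>-r\<close>, these
    eight values are the coordinates of \<open>z\<close> at \<open>Y 2\<close>, \<open>Y 3\<close>,
    \<open>Y 1\<close>, \<open>X 2\<close>, \<open>X 1\<close>, \<open>X 3\<close>,
    \<open>Y 4\<close>, \<open>Y 5\<close>, in this order.\<close>
  note * = this[of "X 1" "b (Y 3)"] this[of "X 1" "b (Y 2)"] this[of "X 2" "b (Y 3)"]
    this[of "X 3" "b (Y 5)"] this[of "X 3" "b (Y 4)"] this[of "X 4" "b (Y 5)"]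
    this[of "Y 1" "b (Y 3)"] this[of "Y 2" "b (Y 3)"]
  show ?thesis
    using * parameter_nonzero by (intro eq_if_coords_eq) (simp_all add: coord_mul)
qed

lemma center_eq: "center L = span {b (X 4), b (X 5)}"
proof
  show "center L \<subseteq> span {b (X 4), b (X 5)}"
    using center_coords by (metis insertI1 insertI2 span_add span_base span_scale subsetI)
  have "subspace (center L)" by (auto simp: subspace_def center_def)
  moreover have "{b (X 4), b (X 5)} \<subseteq> center L"
    by (auto simp: center_def intro!: eq_if_coords_eq simp: coord_mul)
  ultimately show "span {b (X 4), b (X 5)} \<subseteq> center L" by (intro span_minimal)
qed

lemma isotropic_center: "isotropic L (center L)"
  unfolding isotropic_def
proof (intro ballI)
  fix u v assume "u \<in> center L" "v \<in> center L"
  then have u: "u = coord b (X 4) u \<odot> b (X 4) + coord b (X 5) u \<odot> b (X 5)"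
    and v: "v = coord b (X 4) v \<odot> b (X 4) + coord b (X 5) v \<odot> b (X 5)"
    by (auto dest: center_coords)
  show "\<langle>u, v\<rangle> = 0" by (subst u, subst v) (simp add: form_eq_coords)
qed

lemma dim_center: "dim (center L) = 2"
proof -
  have "independent {b (X 4), b (X 5)}"
    using symplectic_family_independent[of 5 b] standard
    by (rule_tac independent_mono) (auto simp: standard_basis_iff labels_5)
  moreover have "b (X 4) \<noteq> b (X 5)"
  proof -
    have "coord b (X 4) (b (X 4)) \<noteq> coord b (X 4) (b (X 5))" by simp
    then show ?thesis by metis
  qed
  ultimately show ?thesis using dim_eq_card[of "{b (X 4), b (X 5)}" "center L"] 
    by (simp add: center_eq span_span)
qed

text \<open>By \<open>coord_mul\<close>, each further multiplication kills the next group of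
  coordinates, in the order \<open>y\<^sub>4, y\<^sub>5\<close>, then \<open>y\<^sub>3\<close>, then
  \<open>y\<^sub>1, y\<^sub>2\<close>, then \<open>x\<^sub>1, x\<^sub>2\<close>, then
  \<open>x\<^sub>3\<close>, then \<open>x\<^sub>4, x\<^sub>5\<close>.\<close>

lemma lower_power_coords:
  "lower_power L 2 \<subseteq> {u. coord b (Y 4) u = 0 \<and> coord b (Y 5) u = 0}" (is "_ \<subseteq> ?W2")
  "lower_power L 3 \<subseteq> {u. coord b (Y 3) u = 0 \<and> coord b (Y 4) u = 0 \<and> coord b (Y 5) u = 0}"
    (is "_ \<subseteq> ?W3")
  "lower_power L 4 \<subseteq> {u. coord b (Y 1) u = 0 \<and> coord b (Y 2) u = 0 \<and> coord b (Y 3) u = 0 \<and>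
     coord b (Y 4) u = 0 \<and> coord b (Y 5) u = 0}" (is "_ \<subseteq> ?W4")
  "lower_power L 5 \<subseteq> {u. coord b (X 1) u = 0 \<and> coord b (X 2) u = 0 \<and> coord b (Y 1) u = 0 \<and>
     coord b (Y 2) u = 0 \<and> coord b (Y 3) u = 0 \<and> coord b (Y 4) u = 0 \<and> coord b (Y 5) u = 0}"
    (is "_ \<subseteq> ?W5")
  "lower_power L 6 \<subseteq> {u. coord b (X 1) u = 0 \<and> coord b (X 2) u = 0 \<and> coord b (X 3) u = 0 \<and>
     coord b (Y 1) u = 0 \<and> coord b (Y 2) u = 0 \<and> coord b (Y 3) u = 0 \<and>
     coord b (Y 4) u = 0 \<and> coord b (Y 5) u = 0}" (is "_ \<subseteq> ?W6")
  "lower_power L 7 \<subseteq> {0}"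
proof -
  have eq: "lower_power L 2 = subspace_mul L UNIV UNIV"
    "lower_power L 3 = subspace_mul L (lower_power L 2) UNIV"
    "lower_power L 4 = subspace_mul L (lower_power L 3) UNIV"
    "lower_power L 5 = subspace_mul L (lower_power L 4) UNIV"
    "lower_power L 6 = subspace_mul L (lower_power L 5) UNIV"
    "lower_power L 7 = subspace_mul L (lower_power L 6) UNIV"
    using lower_power_Suc[of 1] lower_power_Suc[of 2] lower_power_Suc[of 3] lower_power_Suc[of 4]
      lower_power_Suc[of 5] lower_power_Suc[of 6] by (simp_all add: numeral_eq_Suc One_nat_def)
  show 2: "lower_power L 2 \<subseteq> ?W2"
    unfolding eq(1) by (rule subspace_mul_subset) (auto simp: subspace_def coord_mul)
  show 3: "lower_power L 3 \<subseteq> ?W3"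
    unfolding eq(2) by (rule subspace_mul_subset) (use 2 in \<open>auto simp: subspace_def coord_mul\<close>)
  show 4: "lower_power L 4 \<subseteq> ?W4"
    unfolding eq(3) by (rule subspace_mul_subset) (use 3 in \<open>auto simp: subspace_def coord_mul\<close>)
  show 5: "lower_power L 5 \<subseteq> ?W5"
    unfolding eq(4) by (rule subspace_mul_subset) (use 4 in \<open>auto simp: subspace_def coord_mul\<close>)
  show 6: "lower_power L 6 \<subseteq> ?W6"
    unfolding eq(5) by (rule subspace_mul_subset) (use 5 in \<open>auto simp: subspace_def coord_mul\<close>)
  show "lower_power L 7 \<subseteq> {0}"
    unfolding eq(6) by (rule subspace_mul_subset)
      (use 6 in \<open>auto simp: subspace_def intro!: eq_if_coords_eq simp: coord_mul\<close>)
qed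

text \<open>Follows a chain of products: \<open>y\<^sub>4y\<^sub>5\<close> gives
  \<open>y\<^sub>3\<close>, which gives \<open>y\<^sub>1\<close> and \<open>y\<^sub>2\<close>; then
  come \<open>x\<^sub>1\<close>, \<open>x\<^sub>3\<close> and \<open>x\<^sub>5\<close>, each a
  scalar multiple of a product with the previous vector.\<close>

lemma basis_in_lower_power:
  "b (Y 3) \<in> lower_power L 2" "b (Y 1) \<in> lower_power L 3" "b (Y 2) \<in> lower_power L 3"
  "b (X 1) \<in> lower_power L 4" "b (X 3) \<in> lower_power L 5" "b (X 5) \<in> lower_power L 6"
proof -
  have Suc: "Suc 1 = 2" "Suc 2 = 3" "Suc 3 = 4" "Suc 4 = 5" "Suc 5 = 6" by simp_all
  note scale = subspace_scale[OF subspace_lower_power]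
  have "b (Y 4) \<bullet> b (Y 5) \<in> lower_power L 2"
    using mul_in_lower_power[of "b (Y 4)" 1, unfolded Suc] by (simp add: One_nat_def)
  from scale[OF this, of "- inverse r"] show 3: "b (Y 3) \<in> lower_power L 2"
    using parameter_nonzero by (simp add: basis_products)
  from scale[OF mul_in_lower_power[OF 3, of "b (Y 4)", unfolded Suc], of "- 1"]
  show "b (Y 1) \<in> lower_power L 3" by (simp add: basis_products)
  from scale[OF mul_in_lower_power[OF 3, of "b (Y 5)", unfolded Suc], of "- 1"]
  show 2: "b (Y 2) \<in> lower_power L 3" by (simp add: basis_products)
  from mul_in_lower_power[OF 2, of "b (Y 3)", unfolded Suc]
  show x1: "b (X 1) \<in> lower_power L 4" by (simp add: basis_products)
  from scale[OF mul_in_lower_power[OF x1, of "b (Y 4)", unfolded Suc], of "- 1"]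
  show x3: "b (X 3) \<in> lower_power L 5" by (simp add: basis_products)
  from scale[OF mul_in_lower_power[OF x3, of "b (Y 4)", unfolded Suc], of "inverse r"]
  show "b (X 5) \<in> lower_power L 6" using parameter_nonzero by (simp add: basis_products)
qed

lemma basis_nonzero: "b (X 3) \<noteq> 0" "b (X 5) \<noteq> 0"
proof -
  have "coord b (X 3) (b (X 3)) \<noteq> coord b (X 3) 0" "coord b (X 5) (b (X 5)) \<noteq> coord b (X 5) 0"
    by simp_all
  then show "b (X 3) \<noteq> 0" "b (X 5) \<noteq> 0" by metis+
qed

text \<open>The class is exactly 6 since \<open>L\<^sup>7 = 0\<close> while \<open>x\<^sub>5\<close>
  is a nonzero element of \<open>L\<^sup>6\<close>. The product
  \<open>y\<^sub>1y\<^sub>2 = x\<^sub>3\<close> of elements of \<open>L\<^sup>3\<close> is not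
  central.\<close>

theorem class6: "class6_properties L"
  unfolding class6_properties_def
proof (intro conjI)
  have 7: "lower_power L (6 + 1) = {0}"
    using lower_power_coords(6) subspace_0[OF subspace_lower_power, of 7] by auto
  then show "nilpotent L" unfolding nilpotent_def by blast
  show "dim (UNIV :: 'v set) = 10" using standard_basis_dim[OF standard] by simp
  show "nilpotence_class L = 6"
    unfolding nilpotence_class_def
  proof (rule Least_equality)
    fix k assume k: "lower_power L (k + 1) = {0}"
    show "6 \<le> k"
    proof (rule ccontr)
      assume "\<not> 6 \<le> k"
      then have "lower_power L 6 \<subseteq> lower_power L (k + 1)" by (intro lower_power_antimono) simp
      then show False using k basis_in_lower_power(6) basis_nonzero by auto
    qed
  qed (rule 7)
  show "\<not> subspace_mul L (lower_power L 3) (lower_power L 3) \<subseteq> center L"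
  proof
    assume *: "subspace_mul L (lower_power L 3) (lower_power L 3) \<subseteq> center L"
    have "b (Y 1) \<bullet> b (Y 2) \<in> subspace_mul L (lower_power L 3) (lower_power L 3)"
      by (intro mul_in_subspace_mul basis_in_lower_power)
    then have "b (X 3) \<in> center L" using * by (auto simp: basis_products)
    from arg_cong[OF center_coords[OF this], of "coord b (X 3)"] show False by simp
  qed
qed (rule isotropic_center dim_center)+

end

lemma presented_algebra_iff:
  "symplectic_alternating_algebra L \<and> has_presentation L 5 (P10_2_2 r) \<and> r \<noteq> 0 \<longleftrightarrow>
     (\<exists>b. presented_algebra L b r)"
  using symplectic_alternating_algebra.has_presentation_iff[of L r]
  unfolding presented_algebra_def presented_algebra_axioms_def by blast

section \<open>Isomorphism of presented algebras and fourth powers\<close>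

lemma presented_isomorphic_imp_power:
  assumes "presented_algebra L b r" "presented_algebra M c s" "saa_isomorphic L M"
  shows "s / r \<in> nonzero_powers 4"
proof -
  interpret L: presented_algebra L b r by fact
  interpret M: presented_algebra M c s by fact
  obtain \<phi> where "saa_iso L M \<phi>" using assms(3) by (auto simp: saa_isomorphic_def)
  then interpret Vector_Spaces.linear "smul L" "smul M" \<phi>
    by (simp add: saa_iso_def)
  have \<phi>: "\<phi> (mul L x y) = mul M (\<phi> x) (\<phi> y)" "form M (\<phi> x) (\<phi> y) = form L x y" for x y
    using \<open>saa_iso L M \<phi>\<close> by (auto simp: saa_iso_def)
  \<comment> \<open>The images of \<open>y\<^sub>4, y\<^sub>5\<close> determine those of \<open>y\<^sub>3, y\<^sub>1, y\<^sub>2\<close>. With \<open>g = k 3 3\<close> and \<open>d\<close> the determinant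
    of the \<open>(y\<^sub>4, y\<^sub>5)\<close>-block, the relation \<open>y\<^sub>4y\<^sub>5 = -r y\<^sub>3\<close> gives \<open>r g = s d\<close> and \<open>(y\<^sub>1y\<^sub>2, y\<^sub>3) = 1\<close> gives
    \<open>g\<^sup>3 d = 1\<close>, whence \<open>s = r g\<^sup>4\<close>.\<close>
  define y where "y i = \<phi> (b (Y i))" for i
  define k where "k i j = M.coord c (Y i) (y j)" for i j
  have mul: "mul M (y 4) (y 5) = smul M (- r) (y 3)" "mul M (y 3) (y 4) = smul M (- 1) (y 1)"
    "mul M (y 3) (y 5) = smul M (- 1) (y 2)"
    unfolding y_def \<phi>(1)[symmetric] L.basis_products by (simp_all add: neg scale)
  have "form L (mul L (b (Y 1)) (b (Y 2))) (b (Y 3)) = 1"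
    by (simp add: L.basis_products L.form_eq_coords)
  then have 1: "form M (mul M (y 1) (y 2)) (y 3) = 1" by (simp add: y_def flip: \<phi>)
  have k3: "r * k 3 3 = s * (k 4 4 * k 5 5 - k 5 4 * k 4 5)" "k 4 3 = 0" "k 5 3 = 0"
    using arg_cong[OF mul(1), of "M.coord c (Y 3)"] arg_cong[OF mul(1), of "M.coord c (Y 4)"]
      arg_cong[OF mul(1), of "M.coord c (Y 5)"] L.parameter_nonzero
    by (simp_all add: k_def M.coord_mul)
  have k1: "k 1 1 = k 3 3 * k 4 4" "k 2 1 = k 3 3 * k 5 4" "k 3 1 = 0" "k 4 1 = 0" "k 5 1 = 0"
    using arg_cong[OF mul(2), of "M.coord c (Y 1)"] arg_cong[OF mul(2), of "M.coord c (Y 2)"]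
      arg_cong[OF mul(2), of "M.coord c (Y 3)"] arg_cong[OF mul(2), of "M.coord c (Y 4)"]
      arg_cong[OF mul(2), of "M.coord c (Y 5)"] k3
    by (simp_all add: k_def M.coord_mul)
  have k2: "k 1 2 = k 3 3 * k 4 5" "k 2 2 = k 3 3 * k 5 5" "k 3 2 = 0" "k 4 2 = 0" "k 5 2 = 0"
    using arg_cong[OF mul(3), of "M.coord c (Y 1)"] arg_cong[OF mul(3), of "M.coord c (Y 2)"]
      arg_cong[OF mul(3), of "M.coord c (Y 3)"] arg_cong[OF mul(3), of "M.coord c (Y 4)"]
      arg_cong[OF mul(3), of "M.coord c (Y 5)"] k3
    by (simp_all add: k_def M.coord_mul)
  \<comment> \<open>The coordinates of \<open>y 1\<close>, \<open>y 2\<close>, \<open>y 3\<close> at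
    \<open>Y 4\<close> and \<open>Y 5\<close> vanish, so only the determinant at \<open>Y 1\<close>,
    \<open>Y 2\<close>, \<open>Y 3\<close> survives. It is \<open>k 3 3\<close> times the
    determinant of the \<open>(y 1, y 2)\<close>-block, which is \<open>k 3 3\<close> times the
    \<open>(y 4, y 5)\<close>-block.\<close>
  have "k 3 3 ^ 3 * (k 4 4 * k 5 5 - k 5 4 * k 4 5) = 1"
    using 1 k1 k2 k3(2,3)
    by (simp add: M.triple presentation_form_def det3_def k_def) (simp add: algebra_simps power3_eq_cube)
  then have "s = r * k 3 3 ^ 4" "k 3 3 \<noteq> 0" using k3(1) by (algebra, auto)
  then show ?thesis using L.parameter_nonzero by (auto simp: nonzero_powers_def)
qed

lemma power_imp_presented_isomorphic:
  assumes "presented_algebra L b r" "presented_algebra M c s" "s / r \<in> nonzero_powers 4"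
  shows "saa_isomorphic L M"
proof -
  interpret L: presented_algebra L b r by fact
  interpret M: presented_algebra M c s by fact
  obtain a where a: "a \<noteq> 0" "s = a ^ 4 * r"
    using assms(3) L.parameter_nonzero by (auto simp: nonzero_powers_def field_simps)
  \<comment> \<open>The diagonal map \<open>y\<^sub>i \<mapsto> \<mu>\<^sub>i y\<^sub>i\<close>, \<open>x\<^sub>i \<mapsto> \<mu>\<^sub>i\<^sup>-\<^sup>1 x\<^sub>i\<close> respects the triples if
    \<open>s \<mu>\<^sub>4\<mu>\<^sub>5 = r \<mu>\<^sub>3\<close>, \<open>\<mu>\<^sub>3\<mu>\<^sub>5 = \<mu>\<^sub>2\<close>, \<open>\<mu>\<^sub>3\<mu>\<^sub>4 = \<mu>\<^sub>1\<close> and \<open>\<mu>\<^sub>1\<mu>\<^sub>2\<mu>\<^sub>3 = 1\<close>.\<close>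
  define \<mu> where "\<mu> = (\<lambda>i::nat. 1)(1 := inverse a ^ 2, 2 := a, 3 := a, 4 := inverse a ^ 3)"
  \<comment> \<open>The default value of \<open>\<mu>\<close> supplies \<open>\<mu> 5 = 1\<close>.
    Reciprocal factors at \<open>X i\<close> preserve the form.\<close>
  define \<kappa> where "\<kappa> = case_label (\<lambda>i. inverse (\<mu> i)) \<mu>"
  have \<kappa>: "\<kappa> (X 1) = a ^ 2" "\<kappa> (X 2) = inverse a" "\<kappa> (X 3) = inverse a" "\<kappa> (X 4) = a ^ 3" "\<kappa> (X 5) = 1"
    "\<kappa> (Y 1) = inverse a ^ 2" "\<kappa> (Y 2) = a" "\<kappa> (Y 3) = a" "\<kappa> (Y 4) = inverse a ^ 3" "\<kappa> (Y 5) = 1"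
    by (simp_all add: \<kappa>_def \<mu>_def power_inverse)
  have \<kappa>_nonzero: "\<kappa> l \<noteq> 0" for l using a(1) by (cases l) (auto simp: \<kappa>_def \<mu>_def)
  define \<phi> where "\<phi> u = (\<Sum>l\<in>labels 5. smul M (\<kappa> l * L.coord b l u) (c l))" for u
  define \<psi> where "\<psi> w = (\<Sum>l\<in>labels 5. smul L (inverse (\<kappa> l) * M.coord c l w) (b l))" for w
  have \<phi>: "M.coord c l (\<phi> u) = \<kappa> l * L.coord b l u" if "l \<in> labels 5" for l u
    unfolding \<phi>_def using that M.standard by (intro M.coord_combination) (simp_all add: M.standard_basis_iff)
  have \<psi>: "L.coord b l (\<psi> w) = inverse (\<kappa> l) * M.coord c l w" if "l \<in> labels 5" for l w
    unfolding \<psi>_def using that L.standard by (intro L.coord_combination) (simp_all add: L.standard_basis_iff)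
  note \<phi>_coord = \<phi>[unfolded labels_5]
  have "bij \<phi>"
  proof (rule bijI')
    fix u v
    show "\<phi> u = \<phi> v \<longleftrightarrow> u = v"
    proof
      assume "\<phi> u = \<phi> v"
      then have "\<kappa> l * L.coord b l u = \<kappa> l * L.coord b l v" if "l \<in> labels 5" for l
        using \<phi>[OF that] by metis
      then show "u = v" using \<kappa>_nonzero by (intro L.standard_basis_eqI[OF L.standard]) auto
    qed simp
  next
    fix w
    have "w = \<phi> (\<psi> w)"
      by (rule M.standard_basis_eqI[OF M.standard]) (simp add: \<phi> \<psi> \<kappa>_nonzero)
    then show "\<exists>u. w = \<phi> u" by blast
  qed
  moreover have "Vector_Spaces.linear (smul L) (smul M) \<phi>"
    by unfold_locales (rule M.standard_basis_eqI[OF M.standard]; simp add: \<phi> algebra_simps)+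
  moreover have "\<phi> (mul L x y) = mul M (\<phi> x) (\<phi> y)" for x y
    using a by (intro M.eq_if_coords_eq)
      (simp_all add: \<phi>_coord M.coord_mul L.coord_mul \<kappa> field_simps power2_eq_square
        power3_eq_cube power4_eq_xxxx)
  moreover have "form M (\<phi> x) (\<phi> y) = form L x y" for x y
    using a(1) by (simp add: M.form_eq_coords L.form_eq_coords \<phi>_coord \<kappa> field_simps)
  ultimately show ?thesis unfolding saa_isomorphic_def saa_iso_def by blast
qed


section \<open>An explicit model on \<open>'f ^ 10\<close> for every nonzero parameter\<close>

lemma vector_space_vector_smult:
  "vector_space ((*s) :: 'f::field \<Rightarrow> 'f ^ 'n \<Rightarrow> 'f ^ 'n)"
  by unfold_locales (simp_all add: vec_eq_iff algebra_simps)

lemma exists_presented_algebra: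
  fixes r :: "'f::field"
  assumes "r \<noteq> 0"
  shows "\<exists>L :: ('f, 'f ^ 10) saa. symplectic_alternating_algebra L \<and> has_presentation L 5 (P10_2_2 r)"
proof -
  have "card (labels 5) = card (UNIV :: 10 set)" by (simp add: card_labels)
  \<comment> \<open>Any bijection will do; it lets the ten components be addressed by
    labels.\<close>
  then obtain e :: "label \<Rightarrow> 10" where e: "bij_betw e (labels 5) UNIV"
    by (meson finite_labels finite finite_same_card_bij)
  have e_eq: "e l = e m \<longleftrightarrow> l = m"
    if "l \<in> {X 1, X 2, X 3, X 4, X 5, Y 1, Y 2, Y 3, Y 4, Y 5}"
      "m \<in> {X 1, X 2, X 3, X 4, X 5, Y 1, Y 2, Y 3, Y 4, Y 5}" for l m
    using e that unfolding bij_betw_def labels_5 by (meson inj_on_eq_iff)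
  have vec_eqI: "u = v" if "\<And>l. l \<in> labels 5 \<Longrightarrow> u $ e l = v $ e l" for u v :: "'f ^ 10"
    unfolding vec_eq_iff
  proof
    fix j
    obtain l where "l \<in> labels 5" "j = e l" using e unfolding bij_betw_def by blast
    then show "u $ j = v $ j" using that by simp
  qed
  define B where "B u v =
    u $ e (X 1) * v $ e (Y 1) - u $ e (Y 1) * v $ e (X 1) + u $ e (X 2) * v $ e (Y 2) - u $ e (Y 2) * v $ e (X 2) +
    u $ e (X 3) * v $ e (Y 3) - u $ e (Y 3) * v $ e (X 3) + u $ e (X 4) * v $ e (Y 4) - u $ e (Y 4) * v $ e (X 4) +
    u $ e (X 5) * v $ e (Y 5) - u $ e (Y 5) * v $ e (X 5)" for u v :: "'f ^ 10"
  define D where "D l m u v = u $ e l * v $ e m - u $ e m * v $ e l" for l m and u v :: "'f ^ 10"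
  \<comment> \<open>The product is found by solving \<open>(uv, w) = presentation_form\<close> for
    \<open>uv\<close>; its components are those of \<open>coord_mul\<close>.\<close>
  define P :: "'f ^ 10 \<Rightarrow> 'f ^ 10 \<Rightarrow> 'f ^ 10" where
    "P u v = axis (e (X 1)) (D (Y 2) (Y 3) u v) + axis (e (X 2)) (D (Y 3) (Y 1) u v) +
      axis (e (X 3)) (D (Y 1) (Y 2) u v - D (X 2) (Y 5) u v - D (X 1) (Y 4) u v) +
      axis (e (X 4)) (D (X 1) (Y 3) u v - r * D (X 3) (Y 5) u v) +
      axis (e (X 5)) (D (X 2) (Y 3) u v + r * D (X 3) (Y 4) u v) -
      axis (e (Y 1)) (D (Y 3) (Y 4) u v) - axis (e (Y 2)) (D (Y 3) (Y 5) u v) -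
      axis (e (Y 3)) (r * D (Y 4) (Y 5) u v)" for u v
  have P_nth: "P u v $ e (X 1) = D (Y 2) (Y 3) u v" "P u v $ e (X 2) = D (Y 3) (Y 1) u v"
    "P u v $ e (X 3) = D (Y 1) (Y 2) u v - D (X 2) (Y 5) u v - D (X 1) (Y 4) u v"
    "P u v $ e (X 4) = D (X 1) (Y 3) u v - r * D (X 3) (Y 5) u v"
    "P u v $ e (X 5) = D (X 2) (Y 3) u v + r * D (X 3) (Y 4) u v"
    "P u v $ e (Y 1) = - D (Y 3) (Y 4) u v" "P u v $ e (Y 2) = - D (Y 3) (Y 5) u v"
    "P u v $ e (Y 3) = - r * D (Y 4) (Y 5) u v" "P u v $ e (Y 4) = 0" "P u v $ e (Y 5) = 0" for u v
    by (simp_all add: P_def axis_def e_eq del: One_nat_def)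
  define b where "b l = axis (e l) (1 :: 'f)" for l
  have b_nth: "b l $ e m = (if l = m then 1 else 0)"
    if "l \<in> {X 1, X 2, X 3, X 4, X 5, Y 1, Y 2, Y 3, Y 4, Y 5}"
      "m \<in> {X 1, X 2, X 3, X 4, X 5, Y 1, Y 2, Y 3, Y 4, Y 5}" for l m
    using e_eq[OF that] by (auto simp: b_def axis_def)
  define L where "L = \<lparr>smul = (*s), form = B, mul = P\<rparr>"
  have L [simp]: "smul L = (*s)" "form L = B" "mul L = P" by (simp_all add: L_def)
  interpret V: vector_space "(*s) :: 'f \<Rightarrow> 'f ^ 10 \<Rightarrow> 'f ^ 10" by (rule vector_space_vector_smult)
  have span: "V.span (b ` labels 5) = UNIV"
  proof -
    have "u \<in> V.span (b ` labels 5)" for u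
    proof -
      have "u = (\<Sum>l\<in>labels 5. u $ e l *s b l)"
        by (rule vec_eqI) (auto simp: labels_5 b_nth simp del: One_nat_def)
      moreover have "(\<Sum>l\<in>labels 5. u $ e l *s b l) \<in> V.span (b ` labels 5)"
        by (intro V.span_sum V.span_scale V.span_base) auto
      ultimately show ?thesis by metis
    qed
    then show ?thesis by blast
  qed
  interpret S: symplectic_alternating_algebra L
  proof (intro symplectic_alternating_algebra.intro symplectic_alternating_algebra_axioms.intro)
    show "vector_space (smul L)" by (simp add: vector_space_vector_smult)
    show "\<exists>B. finite B \<and> module.span (smul L) B = UNIV"
      using span by (intro exI[of _ "b ` labels 5"]) simp
    show "Vector_Spaces.linear (smul L) (*) (\<lambda>x. form L x y)" for y
      unfolding L by unfold_locales (simp_all add: B_def algebra_simps)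
    show "Vector_Spaces.linear (smul L) (*) (\<lambda>y. form L x y)" for x
      unfolding L by unfold_locales (simp_all add: B_def algebra_simps)
    show "form L x x = 0" for x by (simp add: B_def)
    show "x = 0" if "\<And>y. form L x y = 0" for x
    proof (rule vec_eqI)
      fix l assume "l \<in> labels 5"
      have "B x (b m) = 0" for m using that by simp
      note * = this[of "X 1"] this[of "X 2"] this[of "X 3"] this[of "X 4"] this[of "X 5"]
        this[of "Y 1"] this[of "Y 2"] this[of "Y 3"] this[of "Y 4"] this[of "Y 5"]
      show "x $ e l = 0 $ e l"
        using * \<open>l \<in> labels 5\<close> by (auto simp: B_def b_nth labels_5 simp del: One_nat_def)
    qed
    show "Vector_Spaces.linear (smul L) (smul L) (\<lambda>x. mul L x y)" for y
      unfolding L by unfold_locales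
        ((rule vec_eqI, auto simp: labels_5 P_nth D_def algebra_simps simp del: One_nat_def)+)
    show "Vector_Spaces.linear (smul L) (smul L) (\<lambda>y. mul L x y)" for x
      unfolding L by unfold_locales
        ((rule vec_eqI, auto simp: labels_5 P_nth D_def algebra_simps simp del: One_nat_def)+)
    show "mul L x x = 0" for x
      unfolding L by (rule vec_eqI) (auto simp: labels_5 P_nth D_def simp del: One_nat_def)
    show "form L (mul L x y) z = form L (mul L y z) x" for x y z
      unfolding L B_def P_nth D_def by algebra
  qed
  have coord: "S.coord b l u = u $ e l" if "l \<in> labels 5" for l u
    using that by (auto simp: labels_5 B_def b_nth simp del: One_nat_def)
  have "S.symplectic_family 5 b"
    unfolding S.symplectic_family_def
  proof (intro ballI)
    fix i j :: nat assume "i \<in> {1..5}" "j \<in> {1..5}"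
    then have "i \<in> {1, 2, 3, 4, 5}" "j \<in> {1, 2, 3, 4, 5}" by auto
    then show "form L (b (X i)) (b (X j)) = 0 \<and> form L (b (Y i)) (b (Y j)) = 0 \<and>
      form L (b (X i)) (b (Y j)) = (if i = j then 1 else 0)"
      unfolding L B_def by (elim insertE emptyE) (simp_all add: b_nth del: One_nat_def)
  qed
  then have "standard_basis L 5 b" using span by (simp add: S.standard_basis_iff)
  moreover have "form L (mul L u v) w = presentation_form (S.coord b) r u v w" for u v w
  proof -
    have *: "S.coord b (X 1) u = u $ e (X 1)" "S.coord b (X 2) u = u $ e (X 2)"
      "S.coord b (X 3) u = u $ e (X 3)" "S.coord b (Y 1) u = u $ e (Y 1)"
      "S.coord b (Y 2) u = u $ e (Y 2)" "S.coord b (Y 3) u = u $ e (Y 3)"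
      "S.coord b (Y 4) u = u $ e (Y 4)" "S.coord b (Y 5) u = u $ e (Y 5)" for u
      by (intro coord; simp add: labels_5)+
    show ?thesis
      unfolding presentation_form_def det3_def * L B_def P_nth D_def by algebra
  qed
  ultimately have "has_presentation L 5 (P10_2_2 r)" unfolding S.has_presentation_iff by blast
  then show ?thesis using S.symplectic_alternating_algebra_axioms by blast
qed


subsection \<open>The lower central series and the form\<close>

context symplectic_alternating_algebra
begin

text \<open>Since \<open>(ac, v) = (a, vc)\<close>, a factor can be moved from the left argument to
  the right until the left one lies in \<open>L\<close>. Then the right one lies in
  \<open>L\<^sup>i\<^sup>+\<^sup>j\<^sup>+\<^sup>1 = 0\<close>.\<close>

lemma lower_power_perp:
  assumes "lower_power L (i + j + 1) = {0}" "u \<in> lower_power L (Suc i)" "v \<in> lower_power L (Suc j)"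
  shows "\<langle>u, v\<rangle> = 0"
  using assms
proof (induction i arbitrary: j u v)
  case 0
  then show ?case by simp
next
  case (Suc i)
  have "u \<in> span {a \<bullet> c | a c. a \<in> lower_power L (Suc i) \<and> c \<in> UNIV}"
    using Suc.prems(2) by (simp add: subspace_mul_def)
  then show ?case
  proof (induction rule: span_induct_alt)
    case (step k x w)
    then obtain a c where x: "x = a \<bullet> c" "a \<in> lower_power L (Suc i)" by blast
    have "lower_power L (i + Suc j + 1) = {0}"
      using Suc.prems(1) by (simp only: add_Suc add_Suc_right)
    from this x(2) mul_in_lower_power[OF Suc.prems(3)] have "\<langle>a, v \<bullet> c\<rangle> = 0" by (rule Suc.IH)
    then have "\<langle>x, v\<rangle> = 0"
      using x form_mul_cyclic[of a c v] triple_swap12[of c v a] form_swap[of a "v \<bullet> c"] by simp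
    then show ?case using step by simp
  qed simp
qed

text \<open>By \<open>(zx, w) = (xw, z)\<close>, all products with \<open>z\<close> are orthogonal
  to everything.\<close>

lemma center_if_perp:
  assumes "\<And>w. w \<in> lower_power L 2 \<Longrightarrow> \<langle>w, z\<rangle> = 0"
  shows "z \<in> center L"
proof -
  have "z \<bullet> x = 0" for x
  proof (rule eq_if_form_eq)
    fix w
    have "x \<bullet> w \<in> lower_power L 2" using mul_in_lower_power[of x 1] by (simp add: numeral_2_eq_2)
    then show "\<langle>z \<bullet> x, w\<rangle> = \<langle>0, w\<rangle>" using assms form_mul_cyclic[of z x w] by simp
  qed
  then show ?thesis by (simp add: center_def)
qed

lemma subspace_center: "subspace (center L)"
  by (auto simp: subspace_def center_def)

text \<open>The set is the sum of \<open>W\<close> and the span of \<open>a\<close> and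
  \<open>c\<close>, written so that the coefficients can be extracted.\<close>

lemma subspace_modulo:
  assumes "subspace W"
  shows "subspace {u. \<exists>p q. u - p \<odot> a - q \<odot> c \<in> W}"
  unfolding subspace_def
proof (intro conjI ballI allI)
  show "0 \<in> {u. \<exists>p q. u - p \<odot> a - q \<odot> c \<in> W}"
    using subspace_0[OF assms] by (auto intro!: exI[of _ 0])
next
  fix u v
  assume "u \<in> {u. \<exists>p q. u - p \<odot> a - q \<odot> c \<in> W}" "v \<in> {u. \<exists>p q. u - p \<odot> a - q \<odot> c \<in> W}"
  then obtain p q p' q' where "u - p \<odot> a - q \<odot> c \<in> W" "v - p' \<odot> a - q' \<odot> c \<in> W" by auto
  from subspace_add[OF assms this] have "u + v - (p + p') \<odot> a - (q + q') \<odot> c \<in> W"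
    by (simp add: algebra_simps)
  then show "u + v \<in> {u. \<exists>p q. u - p \<odot> a - q \<odot> c \<in> W}" by blast
next
  fix k u
  assume "u \<in> {u. \<exists>p q. u - p \<odot> a - q \<odot> c \<in> W}"
  then obtain p q where "u - p \<odot> a - q \<odot> c \<in> W" by auto
  from subspace_scale[OF assms this, of k] have "k \<odot> u - (k * p) \<odot> a - (k * q) \<odot> c \<in> W"
    by (simp add: algebra_simps)
  then show "k \<odot> u \<in> {u. \<exists>p q. u - p \<odot> a - q \<odot> c \<in> W}" by blast
qed

text \<open>Take \<open>y, y'\<close> dual to a basis \<open>z1, z2\<close> of the center.
  Subtracting the matching multiples from \<open>u\<close> leaves a vector orthogonal to the center,
  hence to everything orthogonal to \<open>L\<^sup>2\<close>, and so an element of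
  \<open>L\<^sup>2\<close>.\<close>

lemma generators_modulo_square:
  assumes "dim (center L) = 2"
  shows "\<exists>y y'. \<forall>u. \<exists>p q. u - p \<odot> y - q \<odot> y' \<in> lower_power L 2"
proof -
  obtain B where B: "B \<subseteq> center L" "independent B" "center L \<subseteq> span B" "card B = 2"
    using basis_exists[of "center L"] assms by metis
  then obtain z1 z2 where z: "B = {z1, z2}" "z1 \<noteq> z2" by (auto simp: card_2_iff)
  have "z1 \<notin> span {z2}" "z2 \<notin> span {z1}"
    using B(2) z by (auto simp: dependent_def insert_Diff_if)
  then obtain y y' where y: "\<langle>z1, y\<rangle> = 1" "\<langle>z2, y\<rangle> = 0" "\<langle>z2, y'\<rangle> = 1" "\<langle>z1, y'\<rangle> = 0"
    using exists_perp_separating[of "{z2}" z1] exists_perp_separating[of "{z1}" z2] by auto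
  have "u - \<langle>z1, u\<rangle> \<odot> y - \<langle>z2, u\<rangle> \<odot> y' \<in> lower_power L 2" (is "?w \<in> _") for u
  proof (rule subspace_eq_perp_perp[OF subspace_lower_power])
    fix v assume "\<And>w. w \<in> lower_power L 2 \<Longrightarrow> \<langle>w, v\<rangle> = 0"
    then have "v \<in> span {z1, z2}" using center_if_perp B z by auto
    then have "\<langle>v, ?w\<rangle> = 0"
    proof (induction rule: span_induct_alt)
      case (step c x w)
      have "\<langle>x, ?w\<rangle> = 0" using step.hyps y by auto
      then show ?case using step.IH by (simp only: form_left_simps) simp
    qed simp
    then show "\<langle>?w, v\<rangle> = 0" using form_swap by (metis neg_equal_zero neg_0_equal_iff_equal)
  qed
  then show ?thesis by blast
qed

end

locale seventh_power_trivial = symplectic_alternating_algebra L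
  for L :: "('f::field, 'v::ab_group_add) saa" +
  assumes seventh_power: "lower_power L 7 = {0}"
begin

lemma perp:
  assumes "u \<in> lower_power L i" "v \<in> lower_power L j" "8 \<le> i + j" "i \<noteq> 0" "j \<noteq> 0"
  shows "\<langle>u, v\<rangle> = 0"
proof -
  obtain i' j' where ij: "i = Suc i'" "j = Suc j'" using assms by (auto simp: gr0_conv_Suc)
  have "lower_power L (i' + j' + 1) \<subseteq> lower_power L 7"
    using assms ij by (intro lower_power_antimono) simp
  then have "lower_power L (i' + j' + 1) = {0}"
    using seventh_power subspace_0[OF subspace_lower_power] by blast
  then show ?thesis using assms ij lower_power_perp by blast
qed

lemma mul_in_power:
  "u \<in> lower_power L 2 \<Longrightarrow> u \<bullet> v \<in> lower_power L 3" "u \<in> lower_power L 2 \<Longrightarrow> v \<bullet> u \<in> lower_power L 3"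
  "u \<in> lower_power L 3 \<Longrightarrow> u \<bullet> v \<in> lower_power L 4" "u \<in> lower_power L 3 \<Longrightarrow> v \<bullet> u \<in> lower_power L 4"
  "u \<in> lower_power L 4 \<Longrightarrow> u \<bullet> v \<in> lower_power L 5" "u \<in> lower_power L 4 \<Longrightarrow> v \<bullet> u \<in> lower_power L 5"
  "u \<bullet> v \<in> lower_power L 2"
proof -
  have Suc: "Suc 1 = 2" "Suc 2 = 3" "Suc 3 = 4" "Suc 4 = 5" by simp_all
  have 1: "u \<in> lower_power L 2 \<Longrightarrow> u \<bullet> v \<in> lower_power L 3"
    "u \<in> lower_power L 3 \<Longrightarrow> u \<bullet> v \<in> lower_power L 4"
    "u \<in> lower_power L 4 \<Longrightarrow> u \<bullet> v \<in> lower_power L 5" for u v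
    using mul_in_lower_power[of u 2 v] mul_in_lower_power[of u 3 v] mul_in_lower_power[of u 4 v]
    unfolding Suc by blast+
  note neg = subspace_neg[OF subspace_lower_power]
  show "u \<in> lower_power L 2 \<Longrightarrow> u \<bullet> v \<in> lower_power L 3" "u \<in> lower_power L 3 \<Longrightarrow> u \<bullet> v \<in> lower_power L 4"
    "u \<in> lower_power L 4 \<Longrightarrow> u \<bullet> v \<in> lower_power L 5" by (fact 1)+
  show "u \<in> lower_power L 2 \<Longrightarrow> v \<bullet> u \<in> lower_power L 3" "u \<in> lower_power L 3 \<Longrightarrow> v \<bullet> u \<in> lower_power L 4"
    "u \<in> lower_power L 4 \<Longrightarrow> v \<bullet> u \<in> lower_power L 5"
    by (subst mul_swap, intro neg 1, assumption)+
  show "u \<bullet> v \<in> lower_power L 2" using mul_in_lower_power[of u 1 v] by (simp add: numeral_2_eq_2)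
qed

lemma power_subset: "lower_power L 5 \<subseteq> lower_power L 4" "lower_power L 4 \<subseteq> lower_power L 3"
  "lower_power L 3 \<subseteq> lower_power L 2"
  by (intro lower_power_antimono, simp)+

lemmas power_closed =
  subspace_add[OF subspace_lower_power] subspace_diff[OF subspace_lower_power]
  subspace_neg[OF subspace_lower_power] subspace_scale[OF subspace_lower_power]

text \<open>Here \<open>(uv, w) = (vw, u)\<close> pairs \<open>L\<^sup>5\<close> with
  \<open>L\<^sup>3\<close>, and 5 + 3 = 8.\<close>

lemma mul_power3_power4:
  assumes "u \<in> lower_power L 3" "v \<in> lower_power L 4"
  shows "u \<bullet> v = 0" "v \<bullet> u = 0"
proof -
  show *: "u \<bullet> v = 0"
  proof (rule eq_if_form_eq)
    fix w
    show "\<langle>u \<bullet> v, w\<rangle> = \<langle>0, w\<rangle>"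
      using assms perp[of "v \<bullet> w" 5 u 3] mul_in_power(5) form_mul_cyclic[of u v w] by simp
  qed
  then show "v \<bullet> u = 0" using mul_swap[of u v] by simp
qed

lemma triple_power4:
  assumes "u \<in> lower_power L 4" "v \<in> lower_power L 4"
  shows "\<langle>u \<bullet> v, w\<rangle> = 0" "\<langle>u \<bullet> w, v\<rangle> = 0" "\<langle>w \<bullet> u, v\<rangle> = 0"
  using assms mul_power3_power4(1)[of u v] power_subset perp[of "u \<bullet> w" 5 v 4]
    perp[of "w \<bullet> u" 5 v 4] mul_in_power(5,6) by auto

lemma mul_power3_cong:
  assumes "a \<in> lower_power L 3" "c \<in> lower_power L 3" "a' - a \<in> lower_power L 4" "c' - c \<in> lower_power L 4"
  shows "a' \<bullet> c' = a \<bullet> c"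
proof -
  have "(a + e) \<bullet> (c + f) = a \<bullet> c" if "e \<in> lower_power L 4" "f \<in> lower_power L 4" for e f
    using that assms(1,2) power_subset mul_power3_power4(1)[of a f] mul_power3_power4(2)[of c e]
      mul_power3_power4(1)[of e f] by auto
  from this[OF assms(3,4)] show ?thesis by simp
qed

text \<open>By \<open>triple_power4\<close>, the terms with two or three factors in
  \<open>L\<^sup>4\<close> vanish, so only the first-order changes remain.\<close>

lemma triple_shift:
  assumes "u' - u \<in> lower_power L 4" "v' - v \<in> lower_power L 4" "w' - w \<in> lower_power L 4"
  shows "\<langle>u' \<bullet> v', w'\<rangle> = \<langle>u \<bullet> v, w\<rangle> + \<langle>(u' - u) \<bullet> v, w\<rangle> + \<langle>u \<bullet> (v' - v), w\<rangle> + \<langle>u \<bullet> v, w' - w\<rangle>"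
proof -
  have "\<langle>(u + e) \<bullet> (v + f), w + g\<rangle> = \<langle>u \<bullet> v, w\<rangle> + \<langle>e \<bullet> v, w\<rangle> + \<langle>u \<bullet> f, w\<rangle> + \<langle>u \<bullet> v, g\<rangle>"
    if "e \<in> lower_power L 4" "f \<in> lower_power L 4" "g \<in> lower_power L 4" for e f g
    using that by (simp add: triple_power4)
  from this[OF assms] show ?thesis by (simp only: add_diff_cancel_left' diff_add_cancel add.commute[of _ "_ - _"])
qed

text \<open>Modulo the next term of the lower central series, \<open>L\<^sup>2\<close> is spanned by \<open>y = y\<^sub>4y\<^sub>5\<close> and \<open>L\<^sup>3\<close>
  by \<open>a = yy\<^sub>4\<close> and \<open>c = yy\<^sub>5\<close>, so \<open>L\<^sup>3L\<^sup>3\<close> is spanned by \<open>ac\<close>, which is orthogonal to \<open>L\<^sup>3\<close>. If it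
  were also orthogonal to \<open>y\<close>, it would be orthogonal to \<open>L\<^sup>2\<close> and hence central.\<close>

lemma square_nondegenerate:
  assumes "dim (center L) = 2"
    and "\<not> subspace_mul L (lower_power L 3) (lower_power L 3) \<subseteq> center L"
  shows "\<exists>y4 y5. \<langle>((y4 \<bullet> y5) \<bullet> y4) \<bullet> ((y4 \<bullet> y5) \<bullet> y5), y4 \<bullet> y5\<rangle> \<noteq> 0"
proof -
  obtain y4 y5 where gen: "\<exists>p q. u - p \<odot> y4 - q \<odot> y5 \<in> lower_power L 2" for u
    using generators_modulo_square[OF assms(1)] by blast
  define y a c where "y = y4 \<bullet> y5" and "a = y \<bullet> y4" and "c = y \<bullet> y5"
  have y: "y \<in> lower_power L 2" unfolding y_def by (rule mul_in_power)
  have ac: "a \<in> lower_power L 3" "c \<in> lower_power L 3" unfolding a_def c_def by (intro mul_in_power y)+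
  have mod2: "\<exists>p. u - p \<odot> y \<in> lower_power L 3" if "u \<in> lower_power L 2" for u
  proof -
    \<comment> \<open>The second generator \<open>0\<close> specializes
      \<open>subspace_modulo\<close> to a single generator.\<close>
    let ?W = "{u. \<exists>p q. u - p \<odot> y - q \<odot> 0 \<in> lower_power L 3}"
    have "subspace ?W" by (rule subspace_modulo[OF subspace_lower_power])
    moreover have "u \<bullet> v \<in> ?W" for u v
    proof -
      obtain p q p' q' where w: "u - p \<odot> y4 - q \<odot> y5 \<in> lower_power L 2" (is "?w \<in> _")
          "v - p' \<odot> y4 - q' \<odot> y5 \<in> lower_power L 2" (is "?w' \<in> _")
        using gen by metis
      have "u \<bullet> v - (p * q' - q * p') \<odot> y = ?w \<bullet> v + (p \<odot> y4 + q \<odot> y5) \<bullet> ?w'"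
        using mul_swap[of y5 y4] by (simp add: algebra_simps y_def)
      moreover have "\<dots> \<in> lower_power L 3" by (intro power_closed mul_in_power w)
      ultimately have "u \<bullet> v - (p * q' - q * p') \<odot> y - 0 \<odot> 0 \<in> lower_power L 3"
        by (simp only: scale_zero_right diff_zero)
      then show ?thesis by blast
    qed
    ultimately have "subspace_mul L UNIV UNIV \<subseteq> ?W" by (intro subspace_mul_subset)
    then show ?thesis using that by (auto simp: numeral_2_eq_2)
  qed
  have mod3: "\<exists>p q. u - p \<odot> a - q \<odot> c \<in> lower_power L 4" if "u \<in> lower_power L 3" for u
  proof -
    let ?W = "{u. \<exists>p q. u - p \<odot> a - q \<odot> c \<in> lower_power L 4}"
    have "subspace ?W" by (rule subspace_modulo[OF subspace_lower_power])
    moreover have "u \<bullet> v \<in> ?W" if u: "u \<in> lower_power L 2" for u v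
    proof -
      obtain p where w: "u - p \<odot> y \<in> lower_power L 3" (is "?w \<in> _") using mod2 u by blast
      obtain q q' where v: "v - q \<odot> y4 - q' \<odot> y5 \<in> lower_power L 2" (is "?v \<in> _") using gen by metis
      obtain p' where w': "?v - p' \<odot> y \<in> lower_power L 3" (is "?w' \<in> _") using mod2[OF v] by blast
      \<comment> \<open>Modulo \<open>L\<^sup>3\<close>, \<open>v\<close> is a combination of
        \<open>y4\<close>, \<open>y5\<close> and \<open>y\<close>, and the last contributes nothing
        because \<open>y \<bullet> y = 0\<close>.\<close>
      have "u \<bullet> v - (p * q) \<odot> a - (p * q') \<odot> c = ?w \<bullet> v + p \<odot> (y \<bullet> ?w')"
        by (simp add: algebra_simps a_def c_def)
      moreover have "\<dots> \<in> lower_power L 4" by (intro power_closed mul_in_power w w')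
      ultimately have "u \<bullet> v - (p * q) \<odot> a - (p * q') \<odot> c \<in> lower_power L 4" by (simp only:)
      then show ?thesis by blast
    qed
    ultimately have "subspace_mul L (lower_power L 2) UNIV \<subseteq> ?W" by (intro subspace_mul_subset)
    then show ?thesis using that lower_power_Suc[of 2] by (auto simp: numeral_3_eq_3 numeral_2_eq_2)
  qed
  have "\<langle>a \<bullet> c, y\<rangle> \<noteq> 0"
  proof
    assume t: "\<langle>a \<bullet> c, y\<rangle> = 0"
    have ac4: "a \<bullet> c \<in> lower_power L 4" using ac by (intro mul_in_power)
    have central: "a \<bullet> c \<in> center L"
    proof (rule center_if_perp)
      fix u assume u: "u \<in> lower_power L 2"
      obtain p where p: "u - p \<odot> y \<in> lower_power L 3" using mod2[OF u] by blast
      obtain q q' where q: "u - p \<odot> y - q \<odot> a - q' \<odot> c \<in> lower_power L 4" (is "?w \<in> _")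
        using mod3[OF p] by blast
      have "\<langle>a \<bullet> c, ?w\<rangle> = 0" using perp[OF ac4 q] by simp
      then have "\<langle>a \<bullet> c, u\<rangle> = 0" using t by simp
      then show "\<langle>u, a \<bullet> c\<rangle> = 0" using form_swap[of "a \<bullet> c" u] by simp
    qed
    have "u \<bullet> v \<in> center L" if u: "u \<in> lower_power L 3" and v: "v \<in> lower_power L 3" for u v
    proof -
      obtain p q where w: "u - p \<odot> a - q \<odot> c \<in> lower_power L 4" using mod3[OF u] by blast
      obtain p' q' where w': "v - p' \<odot> a - q' \<odot> c \<in> lower_power L 4" using mod3[OF v] by blast
      have "u \<bullet> v = (p \<odot> a + q \<odot> c) \<bullet> (p' \<odot> a + q' \<odot> c)"
      proof (rule mul_power3_cong)
        show "p \<odot> a + q \<odot> c \<in> lower_power L 3" "p' \<odot> a + q' \<odot> c \<in> lower_power L 3"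
          by (intro power_closed ac)+
      qed (use w w' in \<open>simp_all add: diff_diff_eq\<close>)
      also have "\<dots> = (p * q' - q * p') \<odot> (a \<bullet> c)"
        using mul_swap[of c a] by (simp add: algebra_simps)
      finally show ?thesis using subspace_scale[OF subspace_center central] by simp
    qed
    then have "subspace_mul L (lower_power L 3) (lower_power L 3) \<subseteq> center L"
      by (intro subspace_mul_subset subspace_center)
    then show False using assms(2) by blast
  qed
  then show ?thesis unfolding a_def c_def y_def by blast
qed

end


text \<open>Cyclic shifts and one transposition generate all permutations, and both functions vanish
  on repeated arguments. For five indices this leaves ten increasing triples.\<close>

lemma alternating_eqI:
  fixes f g :: "'a::linorder \<Rightarrow> 'a \<Rightarrow> 'a \<Rightarrow> 'b::ab_group_add"
  assumes f: "\<And>i j k. f j i k = - f i j k" "\<And>i j k. f j k i = f i j k" "\<And>i k. f i i k = 0"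
    and g: "\<And>i j k. g j i k = - g i j k" "\<And>i j k. g j k i = g i j k" "\<And>i k. g i i k = 0"
    and eq: "\<And>i j k. \<lbrakk>i < j; j < k; i \<in> S; j \<in> S; k \<in> S\<rbrakk> \<Longrightarrow> f i j k = g i j k"
    and S: "i \<in> S" "j \<in> S" "k \<in> S"
  shows "f i j k = g i j k"
proof -
  have cyc: "f i j k = g i j k" if "f j k i = g j k i" for i j k using that f(2) g(2) by metis
  have swap: "f i j k = g i j k" if "f j i k = g j i k" for i j k using that f(1) g(1) by metis
  have "f i i k = g i i k" for i k using f(3) g(3) by simp
  then have rep: "f i j k = g i j k" if "i = j \<or> j = k \<or> i = k" for i j k
    using that cyc by metis
  show ?thesis
  proof (cases "i = j \<or> j = k \<or> i = k")
    case False
    then consider "i < j" "j < k" | "i < k" "k < j" | "j < i" "i < k" | "j < k" "k < i"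
      | "k < i" "i < j" | "k < j" "j < i" by (metis linorder_neqE)
    then show ?thesis using eq S cyc swap by cases metis+
  qed (rule rep)
qed

subsection \<open>Existence of a presentation\<close>

context seventh_power_trivial
begin

text \<open>The first two substitutions change \<open>a\<close> and \<open>c\<close> only modulo
  \<open>L\<^sup>4\<close>, which fixes \<open>ac\<close>, and the last one is a scaling. So each
  normalization survives the later ones.\<close>

lemma adapted_generators:
  assumes t: "\<langle>((y4 \<bullet> y5) \<bullet> y4) \<bullet> ((y4 \<bullet> y5) \<bullet> y5), y4 \<bullet> y5\<rangle> \<noteq> 0"
  shows "\<exists>y4 y5 r. r \<noteq> 0 \<and>
    \<langle>((y4 \<bullet> y5) \<bullet> y4) \<bullet> ((y4 \<bullet> y5) \<bullet> y5), y4 \<bullet> y5\<rangle> = - (r ^ 3) \<and>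
    \<langle>((y4 \<bullet> y5) \<bullet> y4) \<bullet> ((y4 \<bullet> y5) \<bullet> y5), y4\<rangle> = 0 \<and>
    \<langle>((y4 \<bullet> y5) \<bullet> y4) \<bullet> ((y4 \<bullet> y5) \<bullet> y5), y5\<rangle> = 0 \<and>
    \<langle>(y4 \<bullet> y5) \<bullet> y4, (y4 \<bullet> y5) \<bullet> y5\<rangle> = 0"
proof -
  define y a c where "y = y4 \<bullet> y5" and "a = y \<bullet> y4" and "c = y \<bullet> y5"
  define t where "t = \<langle>a \<bullet> c, y\<rangle>"
  have t0: "t \<noteq> 0" using t unfolding t_def a_def c_def y_def .
  have y: "y \<in> lower_power L 2" unfolding y_def by (rule mul_in_power)
  have ac: "a \<in> lower_power L 3" "c \<in> lower_power L 3" unfolding a_def c_def by (intro mul_in_power y)+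

  \<comment> \<open>Adding multiples of \<open>y\<close> to \<open>y\<^sub>4, y\<^sub>5\<close> changes \<open>a, c\<close> only modulo \<open>L\<^sup>4\<close>, so \<open>ac\<close> stays the same.\<close>
  define \<alpha> \<beta> where "\<alpha> = - \<langle>a \<bullet> c, y4\<rangle> / t" and "\<beta> = - \<langle>a \<bullet> c, y5\<rangle> / t"
  define z4 z5 where "z4 = y4 + \<alpha> \<odot> y" and "z5 = y5 + \<beta> \<odot> y"
  define z d e where "z = z4 \<bullet> z5" and "d = z \<bullet> z4" and "e = z \<bullet> z5"
  have z_eq: "z = y + (\<alpha> \<odot> c - \<beta> \<odot> a)"
    using mul_swap[of y y4] by (simp add: z_def z4_def z5_def y_def[symmetric] c_def a_def algebra_simps)
  have "d - a = (\<alpha> \<odot> c - \<beta> \<odot> a) \<bullet> z4" "e - c = (\<alpha> \<odot> c - \<beta> \<odot> a) \<bullet> z5"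
    unfolding d_def e_def z_eq by (simp_all add: z4_def z5_def a_def[symmetric] c_def[symmetric])
  moreover have "(\<alpha> \<odot> c - \<beta> \<odot> a) \<bullet> w \<in> lower_power L 4" for w
    by (intro mul_in_power power_closed ac)
  ultimately have de4: "d - a \<in> lower_power L 4" "e - c \<in> lower_power L 4" by (simp_all only:)
  have de: "d \<bullet> e = a \<bullet> c" by (rule mul_power3_cong[OF ac de4])
  have z2: "z \<in> lower_power L 2" unfolding z_def by (rule mul_in_power)
  have de3: "d \<in> lower_power L 3" "e \<in> lower_power L 3" unfolding d_def e_def by (intro mul_in_power z2)+
  have tz: "\<langle>d \<bullet> e, z\<rangle> = t" unfolding de z_eq by (simp add: t_def)
  have dez: "\<langle>d \<bullet> e, z4\<rangle> = 0" "\<langle>d \<bullet> e, z5\<rangle> = 0"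
    unfolding de z4_def z5_def using t0 by (simp_all add: \<alpha>_def \<beta>_def t_def[symmetric])

  \<comment> \<open>Adding \<open>p\<close> times the new \<open>a\<close> to \<open>y\<^sub>4\<close> keeps \<open>ac\<close> and shifts \<open>(a, c)\<close> by \<open>p t\<close>.\<close>
  define p where "p = - \<langle>d, e\<rangle> / t"
  define u4 where "u4 = z4 + p \<odot> d"
  define u f g where "u = u4 \<bullet> z5" and "f = u \<bullet> u4" and "g = u \<bullet> z5"
  have u_eq: "u = z + p \<odot> (d \<bullet> z5)" by (simp add: u_def u4_def z_def)
  have dz4: "d \<bullet> z5 \<in> lower_power L 4" by (intro mul_in_power de3)
  have f_eq: "f = d + p \<odot> (z \<bullet> d) + p \<odot> ((d \<bullet> z5) \<bullet> u4)"
    by (simp add: f_def u_eq u4_def d_def[symmetric] algebra_simps)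
  have g_eq: "g = e + p \<odot> ((d \<bullet> z5) \<bullet> z5)"
    by (simp add: g_def u_eq e_def[symmetric])
  have fd: "f - d \<in> lower_power L 4" 
  proof -
    have "p \<odot> (z \<bullet> d) + p \<odot> ((d \<bullet> z5) \<bullet> u4) \<in> lower_power L 4"
      using power_subset dz4 de3 by (intro power_closed mul_in_power(3,4)) auto
    then show ?thesis by (simp add: f_eq algebra_simps)
  qed
  have ge: "g - e \<in> lower_power L 4"
  proof -
    have "p \<odot> ((d \<bullet> z5) \<bullet> z5) \<in> lower_power L 4"
      using power_subset dz4 by (intro power_closed mul_in_power(3)) auto
    then show ?thesis by (simp add: g_eq)
  qed
  have fg: "f \<bullet> g = d \<bullet> e" by (rule mul_power3_cong[OF de3 fd ge])
  have "d \<bullet> e \<in> lower_power L 4" by (intro mul_in_power de3)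
  then have tu: "\<langle>f \<bullet> g, u\<rangle> = t" unfolding fg u_eq using perp[OF _ dz4] tz by simp
  have fgu: "\<langle>f \<bullet> g, u4\<rangle> = 0" "\<langle>f \<bullet> g, z5\<rangle> = 0" unfolding fg u4_def using dez by simp_all
  have fg_form: "\<langle>f, g\<rangle> = 0"
  proof -
    have "u \<in> lower_power L 2" unfolding u_def by (rule mul_in_power)
    then have f3: "f \<in> lower_power L 3" unfolding f_def by (intro mul_in_power)
    \<comment> \<open>The corrections in \<open>L\<^sup>5\<close> are orthogonal to
      \<open>L\<^sup>3\<close>; only the multiple of \<open>z \<bullet> d\<close> in
      \<open>f\<close> counts, and \<open>(zd, e) = (de, z) = t\<close>.\<close>
    have "\<langle>f, g\<rangle> = \<langle>f, e\<rangle>"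
      unfolding g_eq using perp[OF f3 mul_in_power(5)[OF dz4, of z5]] by simp
    also have "\<dots> = \<langle>d, e\<rangle> + p * \<langle>z \<bullet> d, e\<rangle>"
      unfolding f_eq using perp[OF mul_in_power(5)[OF dz4, of u4] de3(2)] by simp
    also have "\<langle>z \<bullet> d, e\<rangle> = t" using tz form_mul_cyclic[of z d e] by simp
    finally show ?thesis using t0 by (simp add: p_def)
  qed

  \<comment> \<open>Scaling \<open>y\<^sub>4\<close> by \<open>\<lambda>\<close> multiplies \<open>t\<close> by \<open>\<lambda>\<^sup>4\<close>; for \<open>\<lambda> = 1/t\<close> the result is a cube.\<close>
  define v4 where "v4 = inverse t \<odot> u4"
  have v: "v4 \<bullet> z5 = inverse t \<odot> u" "(v4 \<bullet> z5) \<bullet> v4 = inverse t ^ 2 \<odot> f" "(v4 \<bullet> z5) \<bullet> z5 = inverse t \<odot> g"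
    by (simp_all add: v4_def u_def f_def g_def power2_eq_square)
  show ?thesis
  proof (intro exI conjI)
    \<comment> \<open>This fixes the witness \<open>r = - inverse t\<close>: the scaled value is
      \<open>t * inverse t ^ 4 = inverse t ^ 3 = - (r ^ 3)\<close>.\<close>
    show "- inverse t \<noteq> 0" using t0 by simp
    show "\<langle>((v4 \<bullet> z5) \<bullet> v4) \<bullet> ((v4 \<bullet> z5) \<bullet> z5), v4 \<bullet> z5\<rangle> = - ((- inverse t) ^ 3)"
      unfolding v(2,3) unfolding v(1) using t0 tu by (simp add: power2_eq_square power3_eq_cube)
    show "\<langle>((v4 \<bullet> z5) \<bullet> v4) \<bullet> ((v4 \<bullet> z5) \<bullet> z5), v4\<rangle> = 0"
      unfolding v(2,3) unfolding v(1) using fgu by (simp add: v4_def)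
    show "\<langle>((v4 \<bullet> z5) \<bullet> v4) \<bullet> ((v4 \<bullet> z5) \<bullet> z5), z5\<rangle> = 0"
      unfolding v(2,3) unfolding v(1) using fgu by simp
    show "\<langle>(v4 \<bullet> z5) \<bullet> v4, (v4 \<bullet> z5) \<bullet> z5\<rangle> = 0"
      unfolding v(2,3) unfolding v(1) using fg_form by simp
  qed
qed

text \<open>The \<open>x i\<close> lie in the isotropic subspace \<open>L\<^sup>4\<close> and are
  dual to the \<open>y i\<close>, so only the pairings among the \<open>y i\<close> need repair.
  Subtracting elements of \<open>L\<^sup>4\<close> from them keeps the duality and all triples
  containing some \<open>x i\<close>.\<close>

lemma presentation_if_adapted_basis:
  fixes x y :: "nat \<Rightarrow> 'v"
  assumes dim: "dim (UNIV :: 'v set) = 10"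
    and x: "\<And>i. i \<in> {1..5} \<Longrightarrow> x i \<in> lower_power L 4"
    and xy: "\<And>i j. i \<in> {1..5} \<Longrightarrow> j \<in> {1..5} \<Longrightarrow> \<langle>x i, y j\<rangle> = (if i = j then 1 else 0)"
    and prods: "y 4 \<bullet> y 5 = - r \<odot> y 3" "y 3 \<bullet> y 4 = - y 1" "y 3 \<bullet> y 5 = - y 2"
    and y12: "y 1 \<in> lower_power L 3" "y 2 \<in> lower_power L 3"
    and T: "\<langle>y 1 \<bullet> y 2, y 3\<rangle> = 1" "\<langle>y 1 \<bullet> y 2, y 4\<rangle> = 0" "\<langle>y 1 \<bullet> y 2, y 5\<rangle> = 0" "\<langle>y 1, y 2\<rangle> = 0"
  shows "has_presentation L 5 (P10_2_2 r)"
proof -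
  have I: "{1..5::nat} = {1, 2, 3, 4, 5}" by auto
  note [simp del] = One_nat_def
  \<comment> \<open>The correction of the \<open>y\<^sub>i\<close> that makes them pairwise orthogonal also annihilates all triples
    \<open>(y\<^sub>iy\<^sub>j, y\<^sub>k)\<close> other than \<open>(y\<^sub>1y\<^sub>2, y\<^sub>3)\<close>.\<close>
  define z where "z i = y i - (\<Sum>j\<in>{i<..5}. \<langle>y i, y j\<rangle> \<odot> x j)" for i
  have z_eq: "z 1 = y 1 - \<langle>y 1, y 3\<rangle> \<odot> x 3 - \<langle>y 1, y 4\<rangle> \<odot> x 4 - \<langle>y 1, y 5\<rangle> \<odot> x 5"
    "z 2 = y 2 - \<langle>y 2, y 3\<rangle> \<odot> x 3 - \<langle>y 2, y 4\<rangle> \<odot> x 4 - \<langle>y 2, y 5\<rangle> \<odot> x 5"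
    "z 3 = y 3 - \<langle>y 3, y 4\<rangle> \<odot> x 4 - \<langle>y 3, y 5\<rangle> \<odot> x 5" "z 4 = y 4 - \<langle>y 4, y 5\<rangle> \<odot> x 5" "z 5 = y 5"
  proof -
    have "{1<..5::nat} = {2, 3, 4, 5}" "{2<..5::nat} = {3, 4, 5}" "{3<..5::nat} = {4, 5}"
      "{4<..5::nat} = {5}" "{5<..5::nat} = {}" by auto
    then show "z 1 = y 1 - \<langle>y 1, y 3\<rangle> \<odot> x 3 - \<langle>y 1, y 4\<rangle> \<odot> x 4 - \<langle>y 1, y 5\<rangle> \<odot> x 5"
      "z 2 = y 2 - \<langle>y 2, y 3\<rangle> \<odot> x 3 - \<langle>y 2, y 4\<rangle> \<odot> x 4 - \<langle>y 2, y 5\<rangle> \<odot> x 5"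
      "z 3 = y 3 - \<langle>y 3, y 4\<rangle> \<odot> x 4 - \<langle>y 3, y 5\<rangle> \<odot> x 5" "z 4 = y 4 - \<langle>y 4, y 5\<rangle> \<odot> x 5" "z 5 = y 5"
      by (simp_all add: z_def T algebra_simps)
  qed
  have xx: "\<langle>x i, x j\<rangle> = 0" if "i \<in> {1..5}" "j \<in> {1..5}" for i j
    using perp[OF x[OF that(1)] x[OF that(2)]] by simp
  have yx: "\<langle>y j, x i\<rangle> = (if i = j then - 1 else 0)" if "i \<in> {1..5}" "j \<in> {1..5}" for i j
    by (subst form_swap) (use xy[OF that] in simp)
  have zy: "z i - y i \<in> lower_power L 4" if "i \<in> {1..5}" for i
  proof -
    have "(\<Sum>j\<in>{i<..5}. \<langle>y i, y j\<rangle> \<odot> x j) \<in> lower_power L 4"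
      using that by (intro subspace_sum[OF subspace_lower_power] power_closed x) auto
    from power_closed(3)[OF this] show ?thesis by (simp add: z_def)
  qed
  define b where "b = case_label x z"
  have b: "b (X i) = x i" "b (Y i) = z i" for i by (simp_all add: b_def)
  have fam: "symplectic_family 5 b"
  proof -
    have xz: "\<langle>x i, z j\<rangle> = (if i = j then 1 else 0)" if "i \<in> {1..5}" "j \<in> {1..5}" for i j
      using xy[OF that] perp[OF x[OF that(1)] zy[OF that(2)]] by simp
    \<comment> \<open>The correction is triangular: for \<open>i < j\<close> the term in
      \<open>z i\<close> cancels \<open>\<langle>y i, y j\<rangle>\<close>, and for
      \<open>j < i\<close> the one in \<open>z j\<close> does.\<close>
    have zz: "\<langle>z i, z j\<rangle> = 0" if "i \<in> {1..5}" "j \<in> {1..5}" for i j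
    proof -
      have "\<langle>z i, z j\<rangle> = \<langle>z i, y j\<rangle> - (\<Sum>k\<in>{j<..5}. \<langle>y j, y k\<rangle> * \<langle>z i, x k\<rangle>)"
        by (subst z_def[of j]) simp
      also have "\<langle>z i, y j\<rangle> = \<langle>y i, y j\<rangle> - (\<Sum>k\<in>{i<..5}. \<langle>y i, y k\<rangle> * \<langle>x k, y j\<rangle>)"
        by (simp add: z_def)
      also have "(\<Sum>k\<in>{i<..5}. \<langle>y i, y k\<rangle> * \<langle>x k, y j\<rangle>) = (\<Sum>k\<in>{i<..5}. if k = j then \<langle>y i, y k\<rangle> else 0)"
        using that by (intro sum.cong) (auto simp: xy)
      also have "\<langle>y i, y j\<rangle> - \<dots> = (if i < j then 0 else \<langle>y i, y j\<rangle>)" using that by simp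
      also have "(\<Sum>k\<in>{j<..5}. \<langle>y j, y k\<rangle> * \<langle>z i, x k\<rangle>) = (\<Sum>k\<in>{j<..5}. if k = i then - \<langle>y j, y k\<rangle> else 0)"
        using that xz form_swap[of "z i"] by (intro sum.cong) auto
      also have "\<dots> = (if j < i then - \<langle>y j, y i\<rangle> else 0)" using that by simp
      finally show ?thesis using form_swap[of "y i" "y j"] by (cases i j rule: linorder_cases) auto
    qed
    show ?thesis using xx xz zz by (simp add: symplectic_family_def b)
  qed
  have standard: "standard_basis L 5 b"
    using standard_basis_if_dim[OF fam] dim by simp
  have xxT: "\<langle>x i \<bullet> x j, w\<rangle> = 0" "\<langle>x i \<bullet> w, x j\<rangle> = 0" "\<langle>w \<bullet> x i, x j\<rangle> = 0"
    if "i \<in> {1..5}" "j \<in> {1..5}" for i j w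
    using triple_power4[OF x[OF that(1)] x[OF that(2)]] by blast+
  have xyy: "\<langle>x i \<bullet> y j, y k\<rangle> = presentation_form label_delta r (X i) (Y j) (Y k)"
    if i: "i \<in> {1..5}" and j: "j \<in> {1..5}" and k: "k \<in> {1..5}" for i j k
  proof -
    \<comment> \<open>After the shift the product involves only \<open>y\<close>s. With a factor
      \<open>y 1\<close> or \<open>y 2\<close> it lies in \<open>L\<^sup>4\<close> and is orthogonal
      to \<open>x i\<close>; the others are given by \<open>prods\<close>.\<close>
    have cyc: "\<langle>x i \<bullet> y j, y k\<rangle> = \<langle>y j \<bullet> y k, x i\<rangle>" by (rule form_mul_cyclic)
    have 0: "\<langle>y 1 \<bullet> v, x i\<rangle> = 0" "\<langle>y 2 \<bullet> v, x i\<rangle> = 0" "\<langle>v \<bullet> y 1, x i\<rangle> = 0" "\<langle>v \<bullet> y 2, x i\<rangle> = 0" for v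
      using perp[OF mul_in_power(3)[OF y12(1)] x[OF i]] perp[OF mul_in_power(3)[OF y12(2)] x[OF i]]
        perp[OF mul_in_power(4)[OF y12(1)] x[OF i]] perp[OF mul_in_power(4)[OF y12(2)] x[OF i]] by simp_all
    have 1: "y 5 \<bullet> y 4 = r \<odot> y 3" "y 4 \<bullet> y 3 = y 1" "y 5 \<bullet> y 3 = y 2"
      using mul_swap prods by (metis add.inverse_inverse scale_minus_left)+
    have "j \<in> {1, 2, 3, 4, 5}" "k \<in> {1, 2, 3, 4, 5}" using j k I by auto
    then show ?thesis
      unfolding cyc
      by (elim insertE emptyE) (use i in \<open>simp_all add: 0 1 prods yx presentation_form_def det3_def label_delta_def\<close>)
  qed
  have xzz: "\<langle>x i \<bullet> z j, z k\<rangle> = presentation_form label_delta r (X i) (Y j) (Y k)"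
    if "i \<in> {1..5}" "j \<in> {1..5}" "k \<in> {1..5}" for i j k
    using xyy[OF that] triple_shift[of "x i" "x i", OF _ zy[OF that(2)] zy[OF that(3)]]
      triple_power4[OF x[OF that(1)] zy[OF that(2)]] triple_power4[OF x[OF that(1)] zy[OF that(3)]]
      subspace_0[OF subspace_lower_power] by simp
  \<comment> \<open>The two possibly nonzero values, for \<open>(1,4,5)\<close> and
    \<open>(2,4,5)\<close>, are cancelled by the \<open>x 3\<close> terms of \<open>z 1\<close> and
    \<open>z 2\<close>, because \<open>(x\<^sub>3y\<^sub>4, y\<^sub>5) = r\<close>.\<close>
  have base: "\<langle>y 1 \<bullet> y 3, y 4\<rangle> = 0" "\<langle>y 1 \<bullet> y 3, y 5\<rangle> = 0" "\<langle>y 1 \<bullet> y 4, y 5\<rangle> = r * \<langle>y 1, y 3\<rangle>"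
    "\<langle>y 2 \<bullet> y 3, y 4\<rangle> = 0" "\<langle>y 2 \<bullet> y 3, y 5\<rangle> = 0" "\<langle>y 2 \<bullet> y 4, y 5\<rangle> = r * \<langle>y 2, y 3\<rangle>"
    "\<langle>y 3 \<bullet> y 4, y 5\<rangle> = 0"
    by (subst form_mul_cyclic, simp add: prods T form_swap[of "y 2" "y 1"] form_swap[of "y 3" "y 1"]
        form_swap[of "y 3" "y 2"])+
  have yxy: "\<langle>y j \<bullet> x i, y k\<rangle> = - \<langle>x i \<bullet> y j, y k\<rangle>" "\<langle>y j \<bullet> y k, x i\<rangle> = \<langle>x i \<bullet> y j, y k\<rangle>" for i j k
    by (rule triple_swap12, rule form_mul_cyclic[symmetric])
  have zzz_sorted: "\<langle>z i \<bullet> z j, z k\<rangle> = presentation_form label_delta r (Y i) (Y j) (Y k)"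
    if "i < j" "j < k" "i \<in> {1..5}" "k \<in> {1..5}" for i j k
  proof -
    have "(i, j, k) \<in> {(1,2,3), (1,2,4), (1,2,5), (1,3,4), (1,3,5), (1,4,5), (2,3,4), (2,3,5), (2,4,5), (3,4,5)}"
    proof -
      have "i \<in> {1, 2, 3, 4, 5}" "j \<in> {1, 2, 3, 4, 5}" "k \<in> {1, 2, 3, 4, 5}" using that by auto
      then show ?thesis using that(1,2) by (elim insertE emptyE; simp)
    qed
    moreover have "\<langle>z i \<bullet> z j, z k\<rangle> = \<langle>y i \<bullet> y j, y k\<rangle> + \<langle>(z i - y i) \<bullet> y j, y k\<rangle>
        + \<langle>y i \<bullet> (z j - y j), y k\<rangle> + \<langle>y i \<bullet> y j, z k - y k\<rangle>"
      using that by (intro triple_shift zy) auto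
    ultimately show ?thesis
      by (elim insertE emptyE) (simp_all add: z_eq base T yxy xyy presentation_form_def det3_def label_delta_def)
  qed
  have zzz: "\<langle>z i \<bullet> z j, z k\<rangle> = presentation_form label_delta r (Y i) (Y j) (Y k)"
    if "i \<in> {1..5}" "j \<in> {1..5}" "k \<in> {1..5}" for i j k
  proof (rule alternating_eqI[where S = "{1..5}" and f = "\<lambda>i j k. \<langle>z i \<bullet> z j, z k\<rangle>"
        and g = "\<lambda>i j k. presentation_form label_delta r (Y i) (Y j) (Y k)"])
    show "\<langle>z j \<bullet> z i, z k\<rangle> = - \<langle>z i \<bullet> z j, z k\<rangle>" for i j k by (rule triple_swap12)
    show "\<langle>z j \<bullet> z k, z i\<rangle> = \<langle>z i \<bullet> z j, z k\<rangle>" for i j k by (rule form_mul_cyclic[symmetric])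
    show "\<langle>z i \<bullet> z i, z k\<rangle> = 0" for i k by simp
  qed (rule presentation_form_alternating zzz_sorted that; assumption?)+
  have "\<langle>b l \<bullet> b m, b n\<rangle> = presentation_form label_delta r l m n"
    if lab: "l \<in> labels 5" "m \<in> labels 5" "n \<in> labels 5" for l m n
  proof -
    let ?E = "\<lambda>l m n. \<langle>b l \<bullet> b m, b n\<rangle> = presentation_form label_delta r l m n"
    \<comment> \<open>A cyclic shift brings every triple of labels to one of the patterns XX*, XYY
      or YYY.\<close>
    have cyc: "?E l m n" if "?E m n l" for l m n
      using that form_mul_cyclic[of "b l" "b m" "b n"] presentation_form_alternating(2)[of label_delta r m n l]
      by (simp only:)
    have XX: "?E (X i) (X j) n" if "i \<in> {1..5}" "j \<in> {1..5}" for i j n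
      using xxT[OF that] by (simp add: b presentation_form_def det3_def label_delta_def)
    have XYY: "?E (X i) (Y j) (Y k)" if "i \<in> {1..5}" "j \<in> {1..5}" "k \<in> {1..5}" for i j k
      using xzz[OF that] by (simp add: b)
    have YYY: "?E (Y i) (Y j) (Y k)" if "i \<in> {1..5}" "j \<in> {1..5}" "k \<in> {1..5}" for i j k
      using zzz[OF that] by (simp add: b)
    show ?thesis
      using lab unfolding labels_def
      by (elim UnE imageE; hypsubst)
        ((rule XX XYY YYY; assumption) | (rule cyc, rule XX XYY; assumption) |
         (rule cyc, rule cyc, rule XX XYY; assumption))+
  qed
  from triple_eq_presentation_form[OF standard this] show ?thesis
    unfolding has_presentation_iff using standard by blast
qed

lemma exists_presentation:
  assumes "dim (UNIV :: 'v set) = 10" "dim (center L) = 2"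
    and "\<not> subspace_mul L (lower_power L 3) (lower_power L 3) \<subseteq> center L"
  shows "\<exists>r. r \<noteq> 0 \<and> has_presentation L 5 (P10_2_2 r)"
proof -
  obtain y4 y5 r where r: "r \<noteq> 0"
    and A: "\<langle>((y4 \<bullet> y5) \<bullet> y4) \<bullet> ((y4 \<bullet> y5) \<bullet> y5), y4 \<bullet> y5\<rangle> = - (r ^ 3)"
    "\<langle>((y4 \<bullet> y5) \<bullet> y4) \<bullet> ((y4 \<bullet> y5) \<bullet> y5), y4\<rangle> = 0"
    "\<langle>((y4 \<bullet> y5) \<bullet> y4) \<bullet> ((y4 \<bullet> y5) \<bullet> y5), y5\<rangle> = 0"
    "\<langle>(y4 \<bullet> y5) \<bullet> y4, (y4 \<bullet> y5) \<bullet> y5\<rangle> = 0"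
    using square_nondegenerate[OF assms(2,3)] adapted_generators by metis
  \<comment> \<open>Dictated by the products in a presented algebra (\<open>basis_products\<close>);
    the normalization \<open>t = -r\<^sup>3\<close> makes
    \<open>(y\<^sub>1y\<^sub>2, y\<^sub>3) = 1\<close>.\<close>
  define y3 y1 y2 where "y3 = - inverse r \<odot> (y4 \<bullet> y5)" and "y1 = inverse r \<odot> ((y4 \<bullet> y5) \<bullet> y4)"
    and "y2 = inverse r \<odot> ((y4 \<bullet> y5) \<bullet> y5)"
  have prods: "y4 \<bullet> y5 = - r \<odot> y3" "y3 \<bullet> y4 = - y1" "y3 \<bullet> y5 = - y2"
    using r by (simp_all add: y1_def y2_def y3_def)
  have T: "\<langle>y1 \<bullet> y2, y3\<rangle> = 1" "\<langle>y1 \<bullet> y2, y4\<rangle> = 0" "\<langle>y1 \<bullet> y2, y5\<rangle> = 0" "\<langle>y1, y2\<rangle> = 0"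
    using r A by (simp_all add: y1_def y2_def y3_def power3_eq_cube field_simps)
  have y3: "y3 \<in> lower_power L 2" unfolding y3_def by (intro power_closed mul_in_power)
  have y12: "y1 \<in> lower_power L 3" "y2 \<in> lower_power L 3"
    unfolding y1_def y2_def by (intro power_closed mul_in_power)+
  \<comment> \<open>The \<open>x\<close>s are forced as well: by \<open>coord_mul\<close>, a
    presented algebra has \<open>y\<^sub>1y\<^sub>2 = x\<^sub>3\<close>,
    \<open>y\<^sub>2y\<^sub>3 = x\<^sub>1\<close>, \<open>y\<^sub>3y\<^sub>1 = x\<^sub>2\<close>,
    \<open>x\<^sub>3y\<^sub>5 = -r x\<^sub>4\<close> and
    \<open>x\<^sub>3y\<^sub>4 = r x\<^sub>5\<close>.\<close>
  define x3 where "x3 = y1 \<bullet> y2"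
  define x1 x2 x4 x5 where "x1 = y2 \<bullet> y3" and "x2 = y3 \<bullet> y1" and "x4 = - inverse r \<odot> (x3 \<bullet> y5)"
    and "x5 = inverse r \<odot> (x3 \<bullet> y4)"
  have x3: "x3 \<in> lower_power L 4" unfolding x3_def by (intro mul_in_power y12)
  have x45: "x4 \<in> lower_power L 5" "x5 \<in> lower_power L 5"
    unfolding x4_def x5_def by (intro power_closed mul_in_power x3)+
  have x: "x1 \<in> lower_power L 4" "x2 \<in> lower_power L 4" "x4 \<in> lower_power L 4" "x5 \<in> lower_power L 4"
    using x45 power_subset y12 unfolding x1_def x2_def by (auto intro: mul_in_power)
  have prods': "y4 \<bullet> y3 = y1" "y5 \<bullet> y3 = y2" "y5 \<bullet> y4 = r \<odot> y3"
    using prods mul_swap by (metis add.inverse_inverse scale_minus_left)+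
  have gram1: "\<langle>x1, y1\<rangle> = 1" "\<langle>x1, y2\<rangle> = 0" "\<langle>x1, y3\<rangle> = 0" "\<langle>x1, y4\<rangle> = 0" "\<langle>x1, y5\<rangle> = 0"
    using T form_mul_cyclic[of y1 y2 y3] form_mul_cyclic[of y2 y3 y4] form_mul_cyclic[of y2 y3 y5]
    by (simp_all add: x1_def prods)
  have gram2: "\<langle>x2, y1\<rangle> = 0" "\<langle>x2, y2\<rangle> = 1" "\<langle>x2, y3\<rangle> = 0" "\<langle>x2, y4\<rangle> = 0" "\<langle>x2, y5\<rangle> = 0"
    using T form_mul_cyclic[of y3 y1 y2] form_mul_cyclic[of y4 y3 y1] form_mul_cyclic[of y5 y3 y1]
      form_swap[of y1 y2] by (simp_all add: x2_def prods')
  have gram3: "\<langle>x3, y1\<rangle> = 0" "\<langle>x3, y2\<rangle> = 0" "\<langle>x3, y3\<rangle> = 1" "\<langle>x3, y4\<rangle> = 0" "\<langle>x3, y5\<rangle> = 0"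
    using T by (simp_all add: x3_def)
  have x3_forms: "\<langle>y1, x3\<rangle> = 0" "\<langle>y2, x3\<rangle> = 0" "\<langle>y3, x3\<rangle> = - 1"
    using gram3 form_swap[of _ x3] by simp_all
  \<comment> \<open>Orthogonality to \<open>y1, y2\<close> is that of \<open>L\<^sup>5\<close> and
    \<open>L\<^sup>3\<close>. The other pairings follow from
    \<open>(x\<^sub>3y\<^sub>5, w) = (y\<^sub>5w, x\<^sub>3)\<close>, and likewise for
    \<open>x5\<close>.\<close>
  have gram4: "\<langle>x4, y1\<rangle> = 0" "\<langle>x4, y2\<rangle> = 0" "\<langle>x4, y3\<rangle> = 0" "\<langle>x4, y4\<rangle> = 1" "\<langle>x4, y5\<rangle> = 0"
    using r perp[OF x45(1)] y12 form_mul_cyclic[of x3 y5] x3_forms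
    by (simp_all add: x4_def prods')
  have gram5: "\<langle>x5, y1\<rangle> = 0" "\<langle>x5, y2\<rangle> = 0" "\<langle>x5, y3\<rangle> = 0" "\<langle>x5, y4\<rangle> = 0" "\<langle>x5, y5\<rangle> = 1"
    using r perp[OF x45(2)] y12 form_mul_cyclic[of x3 y4] x3_forms
    by (simp_all add: x5_def prods prods')
  define x where "x = (\<lambda>i::nat. x5)(1 := x1, 2 := x2, 3 := x3, 4 := x4)"
  define y where "y = (\<lambda>i::nat. y5)(1 := y1, 2 := y2, 3 := y3, 4 := y4)"
  have xs: "x 1 = x1" "x 2 = x2" "x 3 = x3" "x 4 = x4" "x 5 = x5" by (simp_all add: x_def)
  have ys: "y 1 = y1" "y 2 = y2" "y 3 = y3" "y 4 = y4" "y 5 = y5" by (simp_all add: y_def)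
  have I: "{1..5::nat} = {1, 2, 3, 4, 5}" by auto
  have "has_presentation L 5 (P10_2_2 r)"
  proof (rule presentation_if_adapted_basis[of x y])
    show "x i \<in> lower_power L 4" if "i \<in> {1..5}" for i
      using that x \<open>x1 \<in> _\<close> x3 unfolding I by (elim insertE emptyE) (simp_all only: xs)
    show "\<langle>x i, y j\<rangle> = (if i = j then 1 else 0)" if "i \<in> {1..5}" "j \<in> {1..5}" for i j
      using that unfolding I by (elim insertE emptyE)
        (simp_all add: xs ys gram1 gram2 gram3 gram4 gram5 del: One_nat_def)
  qed (simp_all only: ys assms(1) prods y12 T)
  then show ?thesis using r by blast
qed

end

section \<open>Assembly of the classification\<close>

lemma class6_properties_imp_presentation:
  assumes "symplectic_alternating_algebra L" "class6_properties L"
  shows "\<exists>r. r \<noteq> 0 \<and> has_presentation L 5 (P10_2_2 r)"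
proof -
  interpret symplectic_alternating_algebra L by fact
  have *: "nilpotent L" "nilpotence_class L = 6" using assms(2) by (simp_all add: class6_properties_def)
  \<comment> \<open>Nilpotence guarantees that the \<open>LEAST\<close> in the definition of the
    class is attained.\<close>
  then have "lower_power L (nilpotence_class L + 1) = {0}"
    unfolding nilpotent_def nilpotence_class_def by (metis (mono_tags, lifting) LeastI_ex)
  then interpret seventh_power_trivial L using * by unfold_locales simp
  show ?thesis using assms(2) exists_presentation by (simp add: class6_properties_def)
qed

text \<open>The second conjunct provides an algebra for each parameter, so the isomorphism criterion
  concerns algebras that exist. There \<open>L\<close> and \<open>M\<close> may have different
  carrier types, since the criterion should not depend on how the algebras are realized.\<close>

theorem proposition3p2:
  "(\<forall>L :: ('f::field, 'v::ab_group_add) saa.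
      symplectic_alternating_algebra L \<and> class6_properties L \<longrightarrow>
      (\<exists>r. r \<noteq> 0 \<and> has_presentation L 5 (P10_2_2 r))) \<and>
   (\<forall>r :: 'f. r \<noteq> 0 \<longrightarrow>
      (\<exists>L :: ('f, 'f ^ 10) saa.
         symplectic_alternating_algebra L \<and> has_presentation L 5 (P10_2_2 r))) \<and>
   (\<forall>(r :: 'f) (s :: 'f) (L :: ('f, 'v) saa) (M :: ('f, 'w::ab_group_add) saa).
      r \<noteq> 0 \<and> s \<noteq> 0 \<and>
      symplectic_alternating_algebra L \<and> has_presentation L 5 (P10_2_2 r) \<and>
      symplectic_alternating_algebra M \<and> has_presentation M 5 (P10_2_2 s) \<longrightarrow>
      (saa_isomorphic L M \<longleftrightarrow> s / r \<in> nonzero_powers 4)) \<and>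
   (\<forall>(r :: 'f) (L :: ('f, 'v) saa).
      r \<noteq> 0 \<and> symplectic_alternating_algebra L \<and> has_presentation L 5 (P10_2_2 r) \<longrightarrow>
      class6_properties L)"
proof (intro conjI allI impI)
  fix L :: "('f, 'v) saa"
  assume "symplectic_alternating_algebra L \<and> class6_properties L"
  then show "\<exists>r. r \<noteq> 0 \<and> has_presentation L 5 (P10_2_2 r)"
    by (intro class6_properties_imp_presentation) simp_all
next
  fix r :: 'f
  assume "r \<noteq> 0"
  then show "\<exists>L :: ('f, 'f ^ 10) saa.
      symplectic_alternating_algebra L \<and> has_presentation L 5 (P10_2_2 r)"
    by (rule exists_presented_algebra)
next
  fix r s :: 'f and L :: "('f, 'v) saa" and M :: "('f, 'w) saa"
  assume "r \<noteq> 0 \<and> s \<noteq> 0 \<and>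
      symplectic_alternating_algebra L \<and> has_presentation L 5 (P10_2_2 r) \<and>
      symplectic_alternating_algebra M \<and> has_presentation M 5 (P10_2_2 s)"
  then obtain b c where "presented_algebra L b r" "presented_algebra M c s"
    using presented_algebra_iff by metis
  then show "saa_isomorphic L M \<longleftrightarrow> s / r \<in> nonzero_powers 4"
    using presented_isomorphic_imp_power power_imp_presented_isomorphic by metis
next
  fix r :: 'f and L :: "('f, 'v) saa"
  assume "r \<noteq> 0 \<and> symplectic_alternating_algebra L \<and> has_presentation L 5 (P10_2_2 r)"
  then obtain b where "presented_algebra L b r" using presented_algebra_iff by metis
  then show "class6_properties L" by (rule presented_algebra.class6)
qed

end
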